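(* Let $1<\gamma<3$, let $k$ satisfy (A1), and suppose there is $\delta\in(0,2)$ such that $$k'(x)\le \frac{k^2(x)}{(2-\delta)b}\qquad\text{for all }x\in I.$$ Suppose the data $S_0,R_0,S_B,R_B$ satisfy (A2)--(A5). Suppose moreover that for all $x\in I$: if $b\neq-1$, $$\frac{k(x)S_0(x)}{2}\Big(\frac{1}{-b}-\frac{1}{b+1}\xi_0(x)\Big)\le S_0'(x),\qquad \frac{k(x)S_0(x)}{2}\Big(\frac{1}{-b}-\frac{1}{b(b+1)}\xi_0(x)\Big)\le R_0'(x);$$ if $b=-1$, $$\frac{k(x)S_0(x)}{2}\big(1-\epsilon_0(x)\xi_0(x)\big)\le S_0'(x),\qquad \frac{k(x)S_0(x)}{2}\big(1+\xi_0(x)+\epsilon_0(x)\xi_0(x)\big)\le R_0'(x);$$ and that for all $t\in[0,\infty)$: if $b\ne-1$, $$S_B'(t)\le \frac{k(x_B)S_B^2(t)}{2}\Big(\frac1b+\frac{1}{b+1}\xi_B(t)+\frac{1-b}{2(b+1)(1-2b)}\xi_B^2(t)\Big),$$ $$R_B'(t)\le \frac{k(x_B)S_B^2(t)}{2}\Big(\frac1b+\frac{b+2}{b(b+1)}\xi_B(t)-\frac{b^2+3b-2}{2b(b+1)(1-2b)}\xi_B^2(t)\Big);$$ if $b=-1$, $$S_B'(t)\le \frac{k(x_B)S_B^2(t)}{2}\Big(-1+\epsilon_B(t)\xi_B(t)+\frac{2\epsilon_B(t)+1}{6}\xi_B^2(t)\Big),$$ $$R_B'(t)\le \frac{k(x_B)S_B^2(t)}{2}\Big(-1-(\epsilon_B(t)+2)\xi_B(t)-\frac{4\epsilon_B(t)+5}{6}\xi_B^2(t)\Big).$$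 Then there is $\nu_*>0$ such that for every $0<\nu\le\nu_*$ the global $C^1$ solution $(S,R)$ of problem (P) satisfies, for $i=1,2$ and every characteristic curve $\Gamma^i$: along $\Gamma^i$ (as $t$ increases), $S$ is increasing, and $R$ and $\xi$ are decreasing. Moreover, $\xi\to0$ along $\Gamma^i$ if and only if $\rho\to0$ along $\Gamma^i$.
   Context: Constants: $1<\gamma<3$ and $b:=-\frac{3-\gamma}{2(\gamma-1)}<0$ (so $b=-1$ iff $\gamma=5/3$). The interval $I$ is either $[x_B,x_C]$ or $[x_B,\infty)$, with interior $\mathring I$, and $k:I\to[0,\infty)$ is a given function (in applications $k=a'/a$ with $a$ the cross-sectional area of a duct). Problem (P): find $S(x,t),R(x,t)$ with $$S_t+\lambda_1S_x=g,\quad R_t+\lambda_2R_x=-g\quad (x\in\mathring I,\ t>0),$$ $$S(x,0)=S_0(x),\ R(x,0)=R_0(x)\ (x\in I),\qquad S(x_B,t)=S_B(t),\ R(x_B,t)=R_B(t)\ (t\ge0),$$ where $\lambda_1=\frac{\gamma+1}{4}S+\frac{3-\gamma}{4}R$, $\lambda_2=\frac{3-\gamma}{4}S+\frac{\gamma+1}{4}R$, $g=\frac{\gamma-1}{8}k(x)(R^2-S^2)$. The associated (rescaled) density is $\rho=\left(\frac{\gamma-1}{16\nu}\right)^{\frac1{\gamma-1}}(R-S)^{\frac{2}{\gamma-1}}$, and $\xi(x,t):=\frac{R(x,t)}{S(x,t)}-1$. For $i=1,2$, an $i$-th characteristic curve $\Gamma^i$ is a solution curve $x(t)$ in $I\times[0,\infty)$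 of $\frac{dx}{dt}=\lambda_i(S(x,t),R(x,t))$, emanating from a point of the form $(x_0,0)$ with $x_0\in I$ or $(x_B,t_B)$ with $t_B\geq 0$. "Increasing" and "decreasing" are meant in the weak sense (nondecreasing, nonincreasing). "$f\to0$ along $\Gamma^i$" means that $f(x(t),t)\to0$ as $t$ tends to the right endpoint (possibly $\infty$) of the maximal time interval on which the curve stays in $I\times[0,\infty)$. Under the hypotheses of the claim, problem (P) has a unique global $C^1$ solution for all sufficiently small $\nu$; this is the solution referred to. The data $S_0,R_0,S_B,R_B$ may depend on a small parameter $\nu>0$ (the functions $k$ and the constants $\gamma$, $b$ do not); all conditions on the data are assumed for each small $\nu$. A quantity is $O(\sqrt\nu)$ if it is bounded in absolute value by $C\sqrt\nu$ for small $\nu$ with $C$ independent of $\nu$, $x$, $t$. Notation: $\xi_0(x)=\frac{R_0(x)}{S_0(x)}-1$, $\xi_B(t)=\frac{R_B(t)}{S_B(t)}-1$, $\epsilon_0(x)=\ln(S_0(x)\xi_0(x))$, $\epsilon_B(t)=\ln(S_B(t)\xi_B(t))$. Conditions: (A1) $k\ge0$, $k\in C^1(I)$ with bounded $C^1$ norm. (A2) $S_0(x_B)=S_B(0)$, $R_0(x_B)=R_B(0)$, and $S_B'(0)+\big(\frac{\gamma+1}{4}S_0(x_B)+\frac{3-\gamma}{4}R_0(x_B)\big)S_0'(x_B)=\frac{\gamma-1}{8}k(x_B)\big(R_0^2(x_B)-S_0^2(x_B)\big)$, $R_B'(0)+\big(\frac{3-\gamma}{4}S_0(x_B)+\frac{\gamma+1}{4}R_0(x_B)\big)R_0'(x_B)=-\frac{\gamma-1}{8}k(x_B)\big(R_0^2(x_B)-S_0^2(x_B)\big)$.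 (A3) $S_0,R_0\in C^1(I)$ have bounded $C^1$ norms and $0<S_0(x)<R_0(x)$ for all $x\in I$. (A4) $S_B,R_B\in C^1([0,\infty))$ have bounded $C^1$ norms and $0<S_B(t)<R_B(t)$ for all $t\ge0$. (A5) $S_0'(x)\ge0$, $R_0'(x)\ge0$, $\xi_0(x)=O(\sqrt\nu)$ for all $x\in I$; $S_B'(t)\le0$, $R_B'(t)\le0$, $\xi_B(t)=O(\sqrt\nu)$ for all $t\ge0$.
   Formalization: The bounded C^1 norms in (A3) and (A4) are taken bounded uniformly in small ν, not merely for each ν: for b=-1 a bound growing like exp(1/ν) empties the condition on S_0' and S can decrease along Γ^2; for b≠-1 rescaling S, R and t reduces to uniform bounds. *)

theory Defs
  imports "HOL-Analysis.Analysis"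
begin

text \<open>
  The derivative on a set is taken within the set, hence it is one-sided at endpoints.
  It is only used on nondegenerate intervals, where it is unique.
\<close>

definition deriv_on :: "real set \<Rightarrow> (real \<Rightarrow> real) \<Rightarrow> real \<Rightarrow> real" where
  "deriv_on A f x = vector_derivative f (at x within A)"

definition C1_on :: "real set \<Rightarrow> (real \<Rightarrow> real) \<Rightarrow> bool" where
  "C1_on A f \<longleftrightarrow> (\<forall>x\<in>A. f differentiable (at x within A)) \<and> continuous_on A (deriv_on A f)"

definition C1_norm_le :: "real set \<Rightarrow> (real \<Rightarrow> real) \<Rightarrow> real \<Rightarrow> bool" where
  "C1_norm_le A f C \<longleftrightarrow> (\<forall>x\<in>A. \<bar>f x\<bar> \<le> C \<and> \<bar>deriv_on A f x\<bar> \<le> C)"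

definition has_C1_partials ::
  "(real \<times> real) set \<Rightarrow> (real \<Rightarrow> real \<Rightarrow> real) \<Rightarrow> (real \<Rightarrow> real \<Rightarrow> real) \<Rightarrow> (real \<Rightarrow> real \<Rightarrow> real) \<Rightarrow> bool"
where
  "has_C1_partials D f fx ft \<longleftrightarrow>
     (\<forall>(x, t)\<in>D. ((\<lambda>(y, s). f y s) has_derivative (\<lambda>(h, \<tau>). fx x t * h + ft x t * \<tau>))
                    (at (x, t) within D)) \<and>
     continuous_on D (\<lambda>(x, t). fx x t) \<and> continuous_on D (\<lambda>(x, t). ft x t)"

definition lam1 :: "real \<Rightarrow> real \<Rightarrow> real \<Rightarrow> real" where
  "lam1 \<gamma> s r = (\<gamma> + 1) / 4 * s + (3 - \<gamma>) / 4 * r"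

definition lam2 :: "real \<Rightarrow> real \<Rightarrow> real \<Rightarrow> real" where
  "lam2 \<gamma> s r = (3 - \<gamma>) / 4 * s + (\<gamma> + 1) / 4 * r"

definition source :: "real \<Rightarrow> real \<Rightarrow> real \<Rightarrow> real \<Rightarrow> real" where
  "source \<gamma> \<kappa> s r = (\<gamma> - 1) / 8 * \<kappa> * (r\<^sup>2 - s\<^sup>2)"

definition gas_density :: "real \<Rightarrow> real \<Rightarrow> real \<Rightarrow> real \<Rightarrow> real" where
  "gas_density \<gamma> \<nu> s r = ((\<gamma> - 1) / (16 * \<nu>)) powr (1 / (\<gamma> - 1)) * (r - s) powr (2 / (\<gamma> - 1))"

definition xi :: "real \<Rightarrow> real \<Rightarrow> real" where
  "xi s r = r / s - 1"

definition eps :: "real \<Rightarrow> real \<Rightarrow> real" where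
  "eps s r = ln (s * xi s r)"

text \<open>
  A global solution is of class \<open>C\<^sup>1\<close> on all of \<open>I \<times> [0, \<infinity>)\<close>, boundary included.
  Space comes first and time second: \<open>S x t\<close>.
\<close>

definition global_C1_solution ::
  "real \<Rightarrow> real set \<Rightarrow> real \<Rightarrow> (real \<Rightarrow> real) \<Rightarrow>
   (real \<Rightarrow> real) \<Rightarrow> (real \<Rightarrow> real) \<Rightarrow> (real \<Rightarrow> real) \<Rightarrow> (real \<Rightarrow> real) \<Rightarrow>
   (real \<Rightarrow> real \<Rightarrow> real) \<Rightarrow> (real \<Rightarrow> real \<Rightarrow> real) \<Rightarrow> bool"
where
  "global_C1_solution \<gamma> I xB k S0 R0 SB RB S R \<longleftrightarrow>
     (\<exists>Sx St Rx Rt.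
        has_C1_partials (I \<times> {0..}) S Sx St \<and> has_C1_partials (I \<times> {0..}) R Rx Rt \<and>
        (\<forall>x\<in>interior I. \<forall>t>0.
           St x t + lam1 \<gamma> (S x t) (R x t) * Sx x t = source \<gamma> (k x) (S x t) (R x t) \<and>
           Rt x t + lam2 \<gamma> (S x t) (R x t) * Rx x t = - source \<gamma> (k x) (S x t) (R x t))) \<and>
     (\<forall>x\<in>I. S x 0 = S0 x \<and> R x 0 = R0 x) \<and>
     (\<forall>t\<ge>0. S xB t = SB t \<and> R xB t = RB t)"

text \<open>
  A characteristic curve is given by its time interval \<open>J\<close>, whose least element is the starting
  time, and the function \<open>x\<close> on \<open>J\<close>. The speed \<open>lam\<close> is \<open>lam1 \<gamma>\<close> or \<open>lam2 \<gamma>\<close>.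
\<close>

definition char_curve ::
  "real set \<Rightarrow> real \<Rightarrow> (real \<Rightarrow> real \<Rightarrow> real) \<Rightarrow> (real \<Rightarrow> real \<Rightarrow> real) \<Rightarrow> (real \<Rightarrow> real \<Rightarrow> real) \<Rightarrow>
   real set \<Rightarrow> (real \<Rightarrow> real) \<Rightarrow> bool"
where
  "char_curve I xB lam S R J x \<longleftrightarrow>
     is_interval J \<and>
     (\<exists>t0\<in>J. (\<forall>t\<in>J. t0 \<le> t) \<and> (t0 = 0 \<and> x t0 \<in> I \<or> t0 \<ge> 0 \<and> x t0 = xB)) \<and>
     (\<forall>t\<in>J. x t \<in> I \<and>
        (x has_real_derivative lam (S (x t) t) (R (x t) t)) (at t within J))"

text \<open>An extension of a curve may not change its starting time, hence the condition on \<open>J'\<close>.\<close>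

definition maximal_char_curve ::
  "real set \<Rightarrow> real \<Rightarrow> (real \<Rightarrow> real \<Rightarrow> real) \<Rightarrow> (real \<Rightarrow> real \<Rightarrow> real) \<Rightarrow> (real \<Rightarrow> real \<Rightarrow> real) \<Rightarrow>
   real set \<Rightarrow> (real \<Rightarrow> real) \<Rightarrow> bool"
where
  "maximal_char_curve I xB lam S R J x \<longleftrightarrow>
     char_curve I xB lam S R J x \<and>
     (\<forall>J' y. char_curve I xB lam S R J' y \<and> J \<subseteq> J' \<and> (\<forall>t'\<in>J'. \<exists>t\<in>J. t \<le> t') \<and>
             (\<forall>t\<in>J. y t = x t)
        \<longrightarrow> J' = J)"

text \<open>
  The right endpoint is not removed from \<open>J\<close>: this changes nothing for continuous functions,
  except that it gives the limit its obvious meaning, the value at the endpoint, when the curve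
  consists of its starting point only (as for a start at the right end of \<open>I\<close>).
\<close>

definition right_end :: "real set \<Rightarrow> real filter" where
  "right_end J = (if bdd_above J then inf (nhds (Sup J)) (principal J) else at_top)"

text \<open>
  The data \<open>S0 \<nu>\<close>, \<open>R0 \<nu>\<close>, \<open>SB \<nu>\<close>, \<open>RB \<nu>\<close> are families indexed by the small parameter \<open>\<nu>\<close>.
\<close>

definition bounded_C1_coeff :: "real set \<Rightarrow> (real \<Rightarrow> real) \<Rightarrow> bool" where
  "bounded_C1_coeff I k \<longleftrightarrow> (\<forall>x\<in>I. k x \<ge> 0) \<and> C1_on I k \<and> (\<exists>C. C1_norm_le I k C)"

definition compatible_data ::
  "real \<Rightarrow> real set \<Rightarrow> real \<Rightarrow> (real \<Rightarrow> real) \<Rightarrow>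
   (real \<Rightarrow> real \<Rightarrow> real) \<Rightarrow> (real \<Rightarrow> real \<Rightarrow> real) \<Rightarrow> (real \<Rightarrow> real \<Rightarrow> real) \<Rightarrow> (real \<Rightarrow> real \<Rightarrow> real) \<Rightarrow> bool"
where
  "compatible_data \<gamma> I xB k S0 R0 SB RB \<longleftrightarrow>
     (\<forall>\<^sub>F \<nu> in at_right 0.
        S0 \<nu> xB = SB \<nu> 0 \<and> R0 \<nu> xB = RB \<nu> 0 \<and>
        deriv_on {0..} (SB \<nu>) 0 + lam1 \<gamma> (S0 \<nu> xB) (R0 \<nu> xB) * deriv_on I (S0 \<nu>) xB
          = source \<gamma> (k xB) (S0 \<nu> xB) (R0 \<nu> xB) \<and>
        deriv_on {0..} (RB \<nu>) 0 + lam2 \<gamma> (S0 \<nu> xB) (R0 \<nu> xB) * deriv_on I (R0 \<nu>) xB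
          = - source \<gamma> (k xB) (S0 \<nu> xB) (R0 \<nu> xB))"

text \<open>The \<open>C\<^sup>1\<close> norms of the data are bounded uniformly in the parameter \<open>\<nu>\<close>.\<close>

definition admissible_data ::
  "real set \<Rightarrow> (real \<Rightarrow> real \<Rightarrow> real) \<Rightarrow> (real \<Rightarrow> real \<Rightarrow> real) \<Rightarrow> bool"
where
  "admissible_data A S R \<longleftrightarrow>
     (\<exists>C. \<forall>\<^sub>F \<nu> in at_right 0.
        C1_on A (S \<nu>) \<and> C1_on A (R \<nu>) \<and> C1_norm_le A (S \<nu>) C \<and> C1_norm_le A (R \<nu>) C \<and>
        (\<forall>x\<in>A. 0 < S \<nu> x \<and> S \<nu> x < R \<nu> x))"

definition monotone_small_data ::
  "real set \<Rightarrow> (real \<Rightarrow> real \<Rightarrow> real) \<Rightarrow> (real \<Rightarrow> real \<Rightarrow> real) \<Rightarrow>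
   (real \<Rightarrow> real \<Rightarrow> real) \<Rightarrow> (real \<Rightarrow> real \<Rightarrow> real) \<Rightarrow> bool"
where
  "monotone_small_data I S0 R0 SB RB \<longleftrightarrow>
     (\<exists>C. \<forall>\<^sub>F \<nu> in at_right 0.
        (\<forall>x\<in>I. deriv_on I (S0 \<nu>) x \<ge> 0 \<and> deriv_on I (R0 \<nu>) x \<ge> 0 \<and>
               \<bar>xi (S0 \<nu> x) (R0 \<nu> x)\<bar> \<le> C * sqrt \<nu>) \<and>
        (\<forall>t\<ge>0. deriv_on {0..} (SB \<nu>) t \<le> 0 \<and> deriv_on {0..} (RB \<nu>) t \<le> 0 \<and>
               \<bar>xi (SB \<nu> t) (RB \<nu> t)\<bar> \<le> C * sqrt \<nu>))"

text \<open>The next two conditions are for one value of the parameter \<open>\<nu>\<close>.\<close>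

definition initial_slope_bounds ::
  "real \<Rightarrow> real set \<Rightarrow> (real \<Rightarrow> real) \<Rightarrow> (real \<Rightarrow> real) \<Rightarrow> (real \<Rightarrow> real) \<Rightarrow> bool"
where
  "initial_slope_bounds b I k S0 R0 \<longleftrightarrow>
     (\<forall>x\<in>I. let \<xi> = xi (S0 x) (R0 x); \<epsilon> = eps (S0 x) (R0 x) in
        (b \<noteq> -1 \<longrightarrow>
           k x * S0 x / 2 * (1 / (- b) - 1 / (b + 1) * \<xi>) \<le> deriv_on I S0 x \<and>
           k x * S0 x / 2 * (1 / (- b) - 1 / (b * (b + 1)) * \<xi>) \<le> deriv_on I R0 x) \<and>
        (b = -1 \<longrightarrow>
           k x * S0 x / 2 * (1 - \<epsilon> * \<xi>) \<le> deriv_on I S0 x \<and>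
           k x * S0 x / 2 * (1 + \<xi> + \<epsilon> * \<xi>) \<le> deriv_on I R0 x))"

definition boundary_slope_bounds ::
  "real \<Rightarrow> real \<Rightarrow> (real \<Rightarrow> real) \<Rightarrow> (real \<Rightarrow> real) \<Rightarrow> (real \<Rightarrow> real) \<Rightarrow> bool"
where
  "boundary_slope_bounds b xB k SB RB \<longleftrightarrow>
     (\<forall>t\<ge>0. let \<xi> = xi (SB t) (RB t); \<epsilon> = eps (SB t) (RB t) in
        (b \<noteq> -1 \<longrightarrow>
           deriv_on {0..} SB t \<le> k xB * (SB t)\<^sup>2 / 2 *
             (1 / b + 1 / (b + 1) * \<xi> + (1 - b) / (2 * (b + 1) * (1 - 2 * b)) * \<xi>\<^sup>2) \<and>
           deriv_on {0..} RB t \<le> k xB * (SB t)\<^sup>2 / 2 *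
             (1 / b + (b + 2) / (b * (b + 1)) * \<xi>
                - (b\<^sup>2 + 3 * b - 2) / (2 * b * (b + 1) * (1 - 2 * b)) * \<xi>\<^sup>2)) \<and>
        (b = -1 \<longrightarrow>
           deriv_on {0..} SB t \<le> k xB * (SB t)\<^sup>2 / 2 *
             (-1 + \<epsilon> * \<xi> + (2 * \<epsilon> + 1) / 6 * \<xi>\<^sup>2) \<and>
           deriv_on {0..} RB t \<le> k xB * (SB t)\<^sup>2 / 2 *
             (-1 - (\<epsilon> + 2) * \<xi> - (4 * \<epsilon> + 5) / 6 * \<xi>\<^sup>2)))"

end

theory Submission imports Defs begin

text \<open>
  Write \<open>p = S\<^sub>t\<close>, \<open>q = R\<^sub>t\<close>, and let \<open>g \<ge> 0\<close> be the source term, so that \<open>p + \<lambda>\<^sub>1 S\<^sub>x = g\<close> and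
  \<open>q + \<lambda>\<^sub>2 R\<^sub>x = - g\<close>. Along a first characteristic \<open>S\<close> has the derivative \<open>g\<close>, and along a second one
  \<open>R\<close> has the derivative \<open>- g\<close>. The other two derivatives are weighted sums: eliminating \<open>S\<^sub>x\<close> and
  \<open>R\<^sub>x\<close> gives \<open>p (1 - \<lambda>\<^sub>2 / \<lambda>\<^sub>1) + g \<lambda>\<^sub>2 / \<lambda>\<^sub>1\<close> for \<open>S\<close> along second characteristics and
  \<open>q (1 - \<lambda>\<^sub>1 / \<lambda>\<^sub>2) - g \<lambda>\<^sub>1 / \<lambda>\<^sub>2\<close> for \<open>R\<close> along first ones. As \<open>0 < \<lambda>\<^sub>1 \<le> \<lambda>\<^sub>2\<close> when \<open>0 < S < R\<close>,
  all monotonicity claims follow once the region \<open>0 < S < R\<close>, \<open>p \<le> 0\<close>, \<open>q \<le> 0\<close> is known to be invariant.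

  The equivalence of \<open>\<xi> \<rightarrow> 0\<close> and \<open>\<rho> \<rightarrow> 0\<close> is a consequence of these claims: along a curve \<open>S\<close> is
  bounded below and \<open>R\<close> bounded above by positive constants, so both mean that \<open>R - S \<rightarrow> 0\<close>.

  The region is invariant because the system is autonomous in time: differentiating it in \<open>t\<close> yields
  equations along characteristics that are linear in \<open>p\<close> and \<open>q\<close>, with \<open>S\<^sub>x\<close> and \<open>R\<^sub>x\<close> in the coefficients
  and without derivatives of \<open>k\<close>,
  \<open>p\<^sub>t + \<lambda>\<^sub>1 p\<^sub>x = g\<^sub>t - (\<lambda>\<^sub>1)\<^sub>t S\<^sub>x\<close> and \<open>q\<^sub>t + \<lambda>\<^sub>2 q\<^sub>x = - g\<^sub>t - (\<lambda>\<^sub>2)\<^sub>t R\<^sub>x\<close>.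
  At a point where \<open>p = 0\<close> and \<open>q \<le> 0\<close> the right side of the first one is \<open>\<le> 0\<close>, and at a point where
  \<open>q = 0\<close> and \<open>p \<le> 0\<close> so is that of the second one. These are the lemmas \<open>barrier_S_t\<close> and \<open>barrier_R_t\<close>;
  they are stated with an error term, since the maximum principle wants strict inequalities. On the
  parabolic boundary the signs come from the data: \<open>R\<^sub>0' \<ge> 0\<close>, \<open>S\<^sub>B' \<le> 0\<close>, \<open>R\<^sub>B' \<le> 0\<close>, and
  \<open>S\<^sub>t = g - \<lambda>\<^sub>1 S\<^sub>0' \<le> 0\<close> at time 0, because the prescribed lower bound of \<open>S\<^sub>0'\<close> is of the order of \<open>k S\<^sub>0\<close>,
  while \<open>g\<close> is of the order of \<open>k S\<^sub>0\<^sup>2 \<xi>\<^sub>0\<close> with \<open>\<xi>\<^sub>0\<close> small. This is where \<open>\<nu>\<close> has to be small.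

  Two points need care. First, \<open>p\<close> and \<open>q\<close> are only continuous, so their equations are read
  in the sense of uniform limits of \<open>C\<^sup>1\<close> functions (\<open>transport_on\<close>); difference quotients in time
  provide the approximations. Secondly, the maximum principle (\<open>transport_system_positive\<close>) is proved
  without solving for backward characteristics. It looks at a first point where one of finitely many
  functions vanishes and minimizes an approximation, tilted by a small linear function, over the
  backward quadrant of that point. All speeds are positive, so this quadrant contains the backward
  characteristic directions, and rectangles \<open>[x\<^sub>B, x] \<times> [0, T]\<close> contain everything the value at a point depends on.
\<close>

section \<open>Functions of space and time with given partial derivatives\<close>

definition partials_on ::
  "(real \<times> real) set \<Rightarrow> (real \<Rightarrow> real \<Rightarrow> real) \<Rightarrow> (real \<Rightarrow> real \<Rightarrow> real) \<Rightarrow> (real \<Rightarrow> real \<Rightarrow> real) \<Rightarrow> bool"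
where
  "partials_on K u ux ut \<longleftrightarrow>
     (\<forall>(x, t)\<in>K. ((\<lambda>p. u (fst p) (snd p)) has_derivative (\<lambda>h. ux x t * fst h + ut x t * snd h))
                    (at (x, t) within K))"

lemma has_C1_partials_imp_partials_on:
  "has_C1_partials K u ux ut \<Longrightarrow> partials_on K u ux ut"
  by (simp add: has_C1_partials_def partials_on_def case_prod_unfold)

lemma partials_onD:
  "partials_on K u ux ut \<Longrightarrow> (x, t) \<in> K \<Longrightarrow>
   ((\<lambda>p. u (fst p) (snd p)) has_derivative (\<lambda>h. ux x t * fst h + ut x t * snd h)) (at (x, t) within K)"
  unfolding partials_on_def by blast

lemma partials_on_subset:
  "partials_on K u ux ut \<Longrightarrow> L \<subseteq> K \<Longrightarrow> partials_on L u ux ut"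
  unfolding partials_on_def by (auto intro: has_derivative_subset)

lemma partials_on_eqI:
  assumes "partials_on K u ux ut"
    and "\<And>x t. u' x t = u x t" "\<And>x t. ux' x t = ux x t" "\<And>x t. ut' x t = ut x t"
  shows "partials_on K u' ux' ut'"
  using assms by (simp add: partials_on_def)

lemma partials_on_continuous:
  assumes "partials_on K u ux ut"
  shows "continuous_on K (\<lambda>p. u (fst p) (snd p))"
  unfolding continuous_on_eq_continuous_within
proof
  fix p assume "p \<in> K"
  then show "continuous (at p within K) (\<lambda>p. u (fst p) (snd p))"
    using has_derivative_continuous[OF partials_onD[OF assms, of "fst p" "snd p"]] by simp
qed

lemma partials_on_const: "partials_on K (\<lambda>x t. c) (\<lambda>x t. 0) (\<lambda>x t. 0)"
  by (auto simp: partials_on_def)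

lemma partials_on_add:
  assumes "partials_on K u ux ut" "partials_on K v vx vt"
  shows "partials_on K (\<lambda>x t. u x t + v x t) (\<lambda>x t. ux x t + vx x t) (\<lambda>x t. ut x t + vt x t)"
  unfolding partials_on_def
proof (clarify)
  fix x t assume "(x, t) \<in> K"
  from has_derivative_add[OF partials_onD[OF assms(1) this] partials_onD[OF assms(2) this]]
  show "((\<lambda>p. u (fst p) (snd p) + v (fst p) (snd p)) has_derivative
     (\<lambda>h. (ux x t + vx x t) * fst h + (ut x t + vt x t) * snd h)) (at (x, t) within K)"
    by (simp add: algebra_simps)
qed

lemma partials_on_mult:
  assumes "partials_on K u ux ut" "partials_on K v vx vt"
  shows "partials_on K (\<lambda>x t. u x t * v x t)
    (\<lambda>x t. ux x t * v x t + u x t * vx x t) (\<lambda>x t. ut x t * v x t + u x t * vt x t)"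
  unfolding partials_on_def
proof (clarify)
  fix x t assume "(x, t) \<in> K"
  from has_derivative_mult[OF partials_onD[OF assms(1) this] partials_onD[OF assms(2) this]]
  show "((\<lambda>p. u (fst p) (snd p) * v (fst p) (snd p)) has_derivative
     (\<lambda>h. (ux x t * v x t + u x t * vx x t) * fst h + (ut x t * v x t + u x t * vt x t) * snd h))
     (at (x, t) within K)"
    by (rule has_derivative_eq_rhs) (auto simp: algebra_simps)
qed

lemma partials_on_cmult:
  assumes "partials_on K u ux ut"
  shows "partials_on K (\<lambda>x t. c * u x t) (\<lambda>x t. c * ux x t) (\<lambda>x t. c * ut x t)"
  using partials_on_mult[OF partials_on_const assms, of c] by simp

lemma partials_on_diff:
  assumes "partials_on K u ux ut" "partials_on K v vx vt"
  shows "partials_on K (\<lambda>x t. u x t - v x t) (\<lambda>x t. ux x t - vx x t) (\<lambda>x t. ut x t - vt x t)"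
  using partials_on_add[OF assms(1) partials_on_cmult[OF assms(2), of "-1"]] by simp

lemma partials_on_space:
  assumes "\<And>x. x \<in> A \<Longrightarrow> (f has_real_derivative f' x) (at x within A)"
  shows "partials_on (A \<times> B) (\<lambda>x t. f x) (\<lambda>x t. f' x) (\<lambda>x t. 0)"
  unfolding partials_on_def
proof (clarify)
  fix x t assume x: "x \<in> A" and "t \<in> B"
  have "(f has_derivative (\<lambda>h. f' x * h)) (at (fst (x, t)) within fst ` (A \<times> B))"
    using has_derivative_subset[OF assms[OF x, unfolded has_field_derivative_def]] by fastforce
  from has_derivative_in_compose[OF has_derivative_fst[OF has_derivative_ident] this]
  have "((\<lambda>p. f (fst p)) has_derivative (\<lambda>h. f' x * fst h)) (at (x, t) within A \<times> B)" .
  then show "((\<lambda>p. f (fst p)) has_derivative (\<lambda>h. f' x * fst h + 0 * snd h)) (at (x, t) within A \<times> B)"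
    by simp
qed

lemma partials_on_time:
  assumes "\<And>t. (f has_real_derivative f' t) (at t)"
  shows "partials_on K (\<lambda>x t. f t) (\<lambda>x t. 0) (\<lambda>x t. f' t)"
  unfolding partials_on_def
proof (clarify)
  fix x t :: real
  have "(f has_derivative (\<lambda>h. f' t * h)) (at (snd (x, t)))"
    using assms by (simp add: has_field_derivative_def)
  from has_derivative_compose[OF has_derivative_snd[OF has_derivative_ident] this]
  show "((\<lambda>p. f (snd p)) has_derivative (\<lambda>h. 0 * fst h + f' t * snd h)) (at (x, t) within K)"
    by simp
qed

lemma partials_on_shift:
  assumes u: "partials_on D u ux ut" and KD: "\<And>x t. (x, t) \<in> K \<Longrightarrow> (x, t + h) \<in> D"
  shows "partials_on K (\<lambda>x t. u x (t + h)) (\<lambda>x t. ux x (t + h)) (\<lambda>x t. ut x (t + h))"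
  unfolding partials_on_def
proof (clarify)
  fix x t assume K: "(x, t) \<in> K"
  have sub: "(\<lambda>p. (fst p, snd p + h)) ` K \<subseteq> D" using KD by auto
  have 1: "((\<lambda>p. (fst p, snd p + h)) has_derivative (\<lambda>p. (fst p, snd p))) (at (x, t) within K)"
    by (auto intro!: derivative_eq_intros)
  have 2: "((\<lambda>p. u (fst p) (snd p)) has_derivative (\<lambda>p. ux x (t + h) * fst p + ut x (t + h) * snd p))
      (at (fst (x, t), snd (x, t) + h) within (\<lambda>p. (fst p, snd p + h)) ` K)"
    using has_derivative_subset[OF partials_onD[OF u KD[OF K]] sub] by simp
  show "((\<lambda>p. u (fst p) (snd p + h)) has_derivative
     (\<lambda>p. ux x (t + h) * fst p + ut x (t + h) * snd p)) (at (x, t) within K)"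
    using has_derivative_in_compose[OF 1 2] by simp
qed

lemma partials_on_along_curve:
  assumes u: "partials_on K u ux ut"
    and x: "(x has_real_derivative x') (at t within J)" and t: "t \<in> J"
    and K: "\<And>t. t \<in> J \<Longrightarrow> (x t, t) \<in> K"
  shows "((\<lambda>t. u (x t) t) has_real_derivative ux (x t) t * x' + ut (x t) t) (at t within J)"
proof -
  have 1: "((\<lambda>t. (x t, t)) has_derivative (\<lambda>h. (x' * h, h))) (at t within J)"
    using x unfolding has_field_derivative_def
    by (intro has_derivative_Pair has_derivative_ident)
  have 2: "((\<lambda>p. u (fst p) (snd p)) has_derivative
      (\<lambda>h. ux (x t) t * fst h + ut (x t) t * snd h)) (at (x t, t) within (\<lambda>t. (x t, t)) ` J)"
    using K by (intro has_derivative_subset[OF partials_onD[OF u K[OF t]]]) blast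
  have "((\<lambda>t. u (x t) t) has_derivative (\<lambda>h. ux (x t) t * (x' * h) + ut (x t) t * h))
      (at t within J)"
    using has_derivative_in_compose[OF 1 2] by simp
  then show ?thesis
    unfolding has_field_derivative_def by (rule has_derivative_eq_rhs) (simp add: fun_eq_iff algebra_simps)
qed

lemma partials_on_slice_space:
  assumes u: "partials_on (A \<times> B) u ux ut" and xt: "x \<in> A" "t \<in> B"
  shows "((\<lambda>x. u x t) has_real_derivative ux x t) (at x within A)"
proof -
  have 1: "((\<lambda>x. (x, t)) has_derivative (\<lambda>h. (h, 0))) (at x within A)"
    by (intro has_derivative_Pair has_derivative_ident has_derivative_const)
  have sub: "(\<lambda>x. (x, t)) ` A \<subseteq> A \<times> B" using xt by auto
  have "(x, t) \<in> A \<times> B" using xt by simp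
  from has_derivative_in_compose[OF 1 has_derivative_subset[OF partials_onD[OF u this] sub], unfolded fst_conv snd_conv]
  show ?thesis
    unfolding has_field_derivative_def by (rule has_derivative_eq_rhs) (simp add: fun_eq_iff)
qed

lemma partials_on_slice_time:
  assumes "partials_on (A \<times> B) u ux ut" "x \<in> A" "t \<in> B"
  shows "((\<lambda>t. u x t) has_real_derivative ut x t) (at t within B)"
  using partials_on_along_curve[OF assms(1) DERIV_const assms(3), of x] assms(2) by simp

lemma partials_on_mean_value_time:
  assumes u: "partials_on D u ux ut" and h: "0 \<le> h" and D: "\<And>s. t \<le> s \<Longrightarrow> s \<le> t + h \<Longrightarrow> (x, s) \<in> D"
  obtains s where "t \<le> s" "s \<le> t + h" "u x (t + h) - u x t = h * ut x s"
proof -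
  have "((\<lambda>s. u x s) has_derivative (\<lambda>k. ut x s * k)) (at s within {t..t + h})"
    if "t \<le> s" "s \<le> t + h" for s
    using partials_on_along_curve[OF u DERIV_const, of s "{t..t+h}" x] that D
    by (simp add: has_field_derivative_def)
  from mvt_very_simple[OF _ this] h that show thesis
    by (auto simp: mult.commute)
qed

section \<open>Transport equations in the sense of uniform limits\<close>

text \<open>
  The pair \<open>(u, E)\<close> is in the closure, for uniform convergence, of the graph of \<open>\<partial>\<^sub>t + l \<partial>\<^sub>x\<close> on \<open>C\<^sup>1\<close> functions.
  This gives \<open>u\<^sub>t + l u\<^sub>x = E\<close> a meaning for continuous \<open>u\<close>.
\<close>

definition transport_on ::
  "(real \<times> real) set \<Rightarrow> (real \<Rightarrow> real \<Rightarrow> real) \<Rightarrow> (real \<Rightarrow> real \<Rightarrow> real) \<Rightarrow> (real \<Rightarrow> real \<Rightarrow> real) \<Rightarrow> bool"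
where
  "transport_on K l u E \<longleftrightarrow>
     (\<forall>e>0. \<exists>v vx vt. partials_on K v vx vt \<and>
        (\<forall>(x, t)\<in>K. \<bar>v x t - u x t\<bar> \<le> e \<and> \<bar>vt x t + l x t * vx x t - E x t\<bar> \<le> e))"

lemma partials_on_imp_transport_on:
  assumes "partials_on K u ux ut"
    and "\<And>x t. (x, t) \<in> K \<Longrightarrow> E x t = ut x t + l x t * ux x t"
  shows "transport_on K l u E"
  unfolding transport_on_def using assms by (intro allI impI exI[of _ u] exI[of _ ux] exI[of _ ut]) auto

lemma transport_on_diff:
  assumes "transport_on K l u E" "transport_on K l v F"
  shows "transport_on K l (\<lambda>x t. u x t - v x t) (\<lambda>x t. E x t - F x t)"
  unfolding transport_on_def
proof (intro allI impI)
  fix e :: real assume "e > 0"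
  then obtain a ax bt where a: "partials_on K a ax bt"
    "\<forall>(x, t)\<in>K. \<bar>a x t - u x t\<bar> \<le> e/2 \<and> \<bar>bt x t + l x t * ax x t - E x t\<bar> \<le> e/2"
    using assms(1)[unfolded transport_on_def, rule_format, of "e/2"] by auto
  obtain c cx ct where c: "partials_on K c cx ct"
    "\<forall>(x, t)\<in>K. \<bar>c x t - v x t\<bar> \<le> e/2 \<and> \<bar>ct x t + l x t * cx x t - F x t\<bar> \<le> e/2"
    using assms(2)[unfolded transport_on_def, rule_format, of "e/2"] \<open>e > 0\<close> by auto
  have "\<bar>(a x t - c x t) - (u x t - v x t)\<bar> \<le> e \<and>
     \<bar>(bt x t - ct x t) + l x t * (ax x t - cx x t) - (E x t - F x t)\<bar> \<le> e" if "(x, t) \<in> K" for x t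
  proof -
    have "\<bar>a x t - u x t\<bar> \<le> e/2" "\<bar>bt x t + l x t * ax x t - E x t\<bar> \<le> e/2"
      "\<bar>c x t - v x t\<bar> \<le> e/2" "\<bar>ct x t + l x t * cx x t - F x t\<bar> \<le> e/2"
      using a(2) c(2) that by fast+
    then show ?thesis unfolding right_diff_distrib by linarith
  qed
  with partials_on_diff[OF a(1) c(1)]
  show "\<exists>w wx wt. partials_on K w wx wt \<and>
       (\<forall>(x, t)\<in>K. \<bar>w x t - (u x t - v x t)\<bar> \<le> e \<and> \<bar>wt x t + l x t * wx x t - (E x t - F x t)\<bar> \<le> e)"
    by blast
qed

lemma continuous_on_time_modulus:
  fixes w :: "real \<Rightarrow> real \<Rightarrow> real"
  assumes w: "continuous_on ({a..b} \<times> {0..}) (\<lambda>p. w (fst p) (snd p))" and e: "e > 0"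
  obtains d where "d > 0" "\<And>x t s. x \<in> {a..b} \<Longrightarrow> 0 \<le> t \<Longrightarrow> t \<le> T \<Longrightarrow> t \<le> s \<Longrightarrow> s \<le> t + d \<Longrightarrow>
      \<bar>w x s - w x t\<bar> \<le> e"
proof -
  have "uniformly_continuous_on ({a..b} \<times> {0..T + 1}) (\<lambda>p. w (fst p) (snd p))"
    by (intro compact_uniformly_continuous continuous_on_subset[OF w] compact_Times compact_Icc) auto
  from this[unfolded uniformly_continuous_on_def, rule_format, OF e]
  obtain d where d: "d > 0" "\<And>p q. p \<in> {a..b} \<times> {0..T + 1} \<Longrightarrow> q \<in> {a..b} \<times> {0..T + 1} \<Longrightarrow>
      dist q p < d \<Longrightarrow> dist (w (fst q) (snd q)) (w (fst p) (snd p)) < e"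
    by blast
  show thesis
  proof (rule that[of "min 1 (d/2)"])
    fix x t s assume *: "x \<in> {a..b}" "0 \<le> t" "t \<le> T" "t \<le> s" "s \<le> t + min 1 (d/2)"
    have "dist (x, s) (x, t) < d"
      using * d(1) by (auto simp: dist_Pair_Pair dist_real_def)
    moreover have "s \<le> T + 1" using * by auto
    ultimately show "\<bar>w x s - w x t\<bar> \<le> e"
      using d(2)[of "(x, t)" "(x, s)"] * by (auto simp: dist_real_def)
  qed (use d in auto)
qed

lemma continuous_on_rectangle_bound:
  fixes w :: "real \<Rightarrow> real \<Rightarrow> real"
  assumes w: "continuous_on ({a..b} \<times> {0..}) (\<lambda>p. w (fst p) (snd p))"
  obtains B where "B > 0" "\<And>x t. x \<in> {a..b} \<Longrightarrow> 0 \<le> t \<Longrightarrow> t \<le> T \<Longrightarrow> \<bar>w x t\<bar> \<le> B"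
proof -
  have "compact ((\<lambda>p. w (fst p) (snd p)) ` ({a..b} \<times> {0..T}))"
    by (intro compact_continuous_image continuous_on_subset[OF w] compact_Times compact_Icc) auto
  then obtain B where "\<forall>y\<in>(\<lambda>p. w (fst p) (snd p)) ` ({a..b} \<times> {0..T}). norm y \<le> B"
    using compact_imp_bounded bounded_iff by metis
  then show thesis
    by (intro that[of "max 1 B"]) force+
qed

text \<open>
  The equation \<open>u\<^sub>t + l u\<^sub>x = f\<close> may be differentiated in time although \<open>u\<close> is only \<open>C\<^sup>1\<close>. The difference
  quotient \<open>v = (u(x, t + h) - u(x, t)) / h\<close> is \<open>C\<^sup>1\<close>, and subtracting the equations at the times \<open>t + h\<close>
  and \<open>t\<close> expresses \<open>v\<^sub>t + l v\<^sub>x\<close> by difference quotients of \<open>f\<close> and \<open>l\<close> and by \<open>u\<^sub>x\<close> at time \<open>t + h\<close>.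
  All of these converge uniformly on rectangles. The equation is assumed for all times, so that \<open>t + h\<close> is available.
\<close>

lemma transport_on_time_derivative:
  assumes pd: "partials_on ({a..b} \<times> {0..}) u ux ut" "partials_on ({a..b} \<times> {0..}) l lx lt"
      "partials_on ({a..b} \<times> {0..}) f fx ft"
    and c: "continuous_on ({a..b} \<times> {0..}) (\<lambda>p. ux (fst p) (snd p))"
      "continuous_on ({a..b} \<times> {0..}) (\<lambda>p. ut (fst p) (snd p))"
      "continuous_on ({a..b} \<times> {0..}) (\<lambda>p. lt (fst p) (snd p))"
      "continuous_on ({a..b} \<times> {0..}) (\<lambda>p. ft (fst p) (snd p))"
    and eq: "\<And>x t. x \<in> {a..b} \<Longrightarrow> 0 \<le> t \<Longrightarrow> ut x t + l x t * ux x t = f x t"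
  shows "transport_on ({a..b} \<times> {0..T}) l ut (\<lambda>x t. ft x t - lt x t * ux x t)"
  unfolding transport_on_def
proof (intro allI impI)
  fix e :: real assume e: "e > 0"
  let ?K = "{a..b} \<times> {0..T}" and ?D = "{a..b} \<times> {0..}"
  obtain B1 where B1: "B1 > 0" "\<And>x t. x \<in> {a..b} \<Longrightarrow> 0 \<le> t \<Longrightarrow> t \<le> T \<Longrightarrow> \<bar>lt x t\<bar> \<le> B1"
    using continuous_on_rectangle_bound[OF c(3)] by blast
  obtain B2 where B2: "B2 > 0" "\<And>x t. x \<in> {a..b} \<Longrightarrow> 0 \<le> t \<Longrightarrow> t \<le> T + 1 \<Longrightarrow> \<bar>ux x t\<bar> \<le> B2"
    using continuous_on_rectangle_bound[OF c(1)] by blast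
  define e1 where "e1 = e / (1 + B1 + B2)"
  have e1: "e1 > 0" "e1 \<le> e"
    using e B1(1) B2(1) by (auto simp: e1_def field_simps)
  have "e1 * (1 + B1 + B2) = e" using B1(1) B2(1) by (simp add: e1_def)
  then have e1_sum: "e1 + B1 * e1 + B2 * e1 = e" by (simp add: algebra_simps)
  obtain d1 where d1: "d1 > 0" "\<And>x t s. x \<in> {a..b} \<Longrightarrow> 0 \<le> t \<Longrightarrow> t \<le> T \<Longrightarrow> t \<le> s \<Longrightarrow> s \<le> t + d1 \<Longrightarrow>
      \<bar>ux x s - ux x t\<bar> \<le> e1" using continuous_on_time_modulus[OF c(1) e1(1)] by blast
  obtain d2 where d2: "d2 > 0" "\<And>x t s. x \<in> {a..b} \<Longrightarrow> 0 \<le> t \<Longrightarrow> t \<le> T \<Longrightarrow> t \<le> s \<Longrightarrow> s \<le> t + d2 \<Longrightarrow>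
      \<bar>ut x s - ut x t\<bar> \<le> e1" using continuous_on_time_modulus[OF c(2) e1(1)] by blast
  obtain d3 where d3: "d3 > 0" "\<And>x t s. x \<in> {a..b} \<Longrightarrow> 0 \<le> t \<Longrightarrow> t \<le> T \<Longrightarrow> t \<le> s \<Longrightarrow> s \<le> t + d3 \<Longrightarrow>
      \<bar>lt x s - lt x t\<bar> \<le> e1" using continuous_on_time_modulus[OF c(3) e1(1)] by blast
  obtain d4 where d4: "d4 > 0" "\<And>x t s. x \<in> {a..b} \<Longrightarrow> 0 \<le> t \<Longrightarrow> t \<le> T \<Longrightarrow> t \<le> s \<Longrightarrow> s \<le> t + d4 \<Longrightarrow>
      \<bar>ft x s - ft x t\<bar> \<le> e1" using continuous_on_time_modulus[OF c(4) e1(1)] by blast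
  define h where "h = min 1 (min (min d1 d2) (min d3 d4))"
  have h: "h > 0" "h \<le> 1" "h \<le> d1" "h \<le> d2" "h \<le> d3" "h \<le> d4"
    using d1(1) d2(1) d3(1) d4(1) by (auto simp: h_def)
  let ?v = "\<lambda>x t. (1 / h) * (u x (t + h) - u x t)"
  let ?vx = "\<lambda>x t. (1 / h) * (ux x (t + h) - ux x t)"
  let ?vt = "\<lambda>x t. (1 / h) * (ut x (t + h) - ut x t)"
  have "partials_on ?K ?v ?vx ?vt"
    by (intro partials_on_cmult partials_on_diff partials_on_shift[OF pd(1)]
        partials_on_subset[OF pd(1)]) (use h in auto)
  moreover have "\<bar>?v x t - ut x t\<bar> \<le> e \<and> \<bar>?vt x t + l x t * ?vx x t - (ft x t - lt x t * ux x t)\<bar> \<le> e"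
    if "(x, t) \<in> ?K" for x t
  proof
    have xt: "x \<in> {a..b}" "0 \<le> t" "t \<le> T" using that by auto
    have D: "(x, s) \<in> ?D" if "t \<le> s" "s \<le> t + h" for s using that xt by auto
    obtain s where s: "t \<le> s" "s \<le> t + h" "u x (t + h) - u x t = h * ut x s"
      by (rule partials_on_mean_value_time[where t = t and x = x, OF pd(1) less_imp_le[OF h(1)] D])
    obtain r where r: "t \<le> r" "r \<le> t + h" "l x (t + h) - l x t = h * lt x r"
      by (rule partials_on_mean_value_time[where t = t and x = x, OF pd(2) less_imp_le[OF h(1)] D])
    obtain q where q: "t \<le> q" "q \<le> t + h" "f x (t + h) - f x t = h * ft x q"
      by (rule partials_on_mean_value_time[where t = t and x = x, OF pd(3) less_imp_le[OF h(1)] D])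
    have "?v x t = ut x s" using s(3) h(1) by simp
    moreover have "\<bar>ut x s - ut x t\<bar> \<le> e1" using d2(2)[OF xt s(1)] s(2) h by simp
    ultimately show "\<bar>?v x t - ut x t\<bar> \<le> e" using e1 by simp
    have "h * (?vt x t + l x t * ?vx x t)
        = (f x (t + h) - f x t) - (l x (t + h) - l x t) * ux x (t + h)"
      using eq[of x t] eq[of x "t + h"] xt h(1) by (simp add: algebra_simps)
    also have "\<dots> = h * (ft x q - lt x r * ux x (t + h))"
      unfolding q(3) r(3) by (simp add: algebra_simps)
    finally have *: "?vt x t + l x t * ?vx x t = ft x q - lt x r * ux x (t + h)"
      using h(1) by simp
    have "\<bar>ft x q - ft x t\<bar> \<le> e1" using d4(2)[OF xt q(1)] q(2) h by simp
    moreover have "\<bar>(lt x r - lt x t) * ux x (t + h)\<bar> \<le> B2 * e1"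
      unfolding abs_mult mult.commute[of B2] using d3(2)[OF xt r(1)] r(2) B2(2)[of x "t + h"] xt h e1
      by (intro mult_mono) auto
    moreover have "\<bar>lt x t * (ux x (t + h) - ux x t)\<bar> \<le> B1 * e1"
      unfolding abs_mult using d1(2)[OF xt, of "t + h"] B1(2)[of x t] B1(1) xt h e1
      by (intro mult_mono) auto
    moreover have "ft x q - lt x r * ux x (t + h) - (ft x t - lt x t * ux x t)
       = (ft x q - ft x t) - (lt x r - lt x t) * ux x (t + h) - lt x t * (ux x (t + h) - ux x t)"
      by (simp add: algebra_simps)
    ultimately show "\<bar>?vt x t + l x t * ?vx x t - (ft x t - lt x t * ux x t)\<bar> \<le> e"
      unfolding * using e1_sum by linarith
  qed
  ultimately show "\<exists>v vx vt. partials_on ?K v vx vt \<and>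
      (\<forall>(x, t)\<in>?K. \<bar>v x t - ut x t\<bar> \<le> e \<and> \<bar>vt x t + l x t * vx x t - (ft x t - lt x t * ux x t)\<bar> \<le> e)"
    by blast
qed

section \<open>A maximum principle\<close>

text \<open>
  A function that vanishes at a point after having been nonnegative cannot be increasing there in the
  characteristic direction. If \<open>E > 0\<close> at the point, the function would be negative slightly earlier on
  the backward characteristic. To avoid constructing this curve, a \<open>C\<^sup>1\<close> approximation \<open>v\<close> is tilted to
  \<open>w = v - c (x + t)\<close> and minimized over the quadrant \<open>[x0 - r, x0] \<times> [t0 - r, t0]\<close>. The tilt keeps
  the minimum away from the left and lower edges, so the direction \<open>- (l, 1)\<close> points into the
  quadrant at the minimum, and \<open>w\<^sub>t + l w\<^sub>x \<le> 0\<close> there. For small \<open>c\<close> this contradicts \<open>E > 0\<close>.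
\<close>

lemma transport_on_touching:
  assumes tr: "transport_on ({a..b} \<times> {0..T}) l u E"
    and u0: "u x0 t0 = 0" and nonneg: "\<And>x t. x \<in> {a..b} \<Longrightarrow> 0 \<le> t \<Longrightarrow> t \<le> t0 \<Longrightarrow> 0 \<le> u x t"
    and pt: "a < x0" "x0 \<le> b" "0 < t0" "t0 \<le> T"
    and l: "continuous_on ({a..b} \<times> {0..T}) (\<lambda>p. l (fst p) (snd p))" "l x0 t0 > 0"
    and E: "continuous_on ({a..b} \<times> {0..T}) (\<lambda>p. E (fst p) (snd p))"
  shows "E x0 t0 \<le> 0"
proof (rule ccontr)
  assume "\<not> E x0 t0 \<le> 0"
  let ?K = "{a..b} \<times> {0..T}"
  define e where "e = E x0 t0 / 4"
  define m where "m = min e (l x0 t0 / 2)"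
  have e: "e > 0" and m: "m > 0" "m \<le> e" "m \<le> l x0 t0 / 2"
    using \<open>\<not> E x0 t0 \<le> 0\<close> l(2) by (auto simp: e_def m_def)
  have K0: "(x0, t0) \<in> ?K" using pt by auto
  obtain d1 where d1: "d1 > 0" "\<And>x t. (x, t) \<in> ?K \<Longrightarrow> dist (x, t) (x0, t0) < d1 \<Longrightarrow> \<bar>l x t - l x0 t0\<bar> < m"
    using l(1)[unfolded continuous_on_iff, rule_format, OF K0 m(1)] by (auto simp: dist_real_def)
  obtain d2 where d2: "d2 > 0" "\<And>x t. (x, t) \<in> ?K \<Longrightarrow> dist (x, t) (x0, t0) < d2 \<Longrightarrow> \<bar>E x t - E x0 t0\<bar> < m"
    using E(1)[unfolded continuous_on_iff, rule_format, OF K0 m(1)] by (auto simp: dist_real_def)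
  define r where "r = min (min (d1 / 3) (d2 / 3)) (min (x0 - a) t0)"
  have r: "r > 0" "r \<le> d1 / 3" "r \<le> d2 / 3" "a \<le> x0 - r" "0 \<le> t0 - r"
    using d1(1) d2(1) pt by (auto simp: r_def min_def)
  let ?N = "{x0 - r..x0} \<times> {t0 - r..t0}"
  have NK: "?N \<subseteq> ?K" using pt r by auto
  have near: "l x t > 0" "l x t \<le> l x0 t0 + m" "E x t \<ge> 3 * e" if "(x, t) \<in> ?N" for x t
  proof -
    have "dist (x, t) (x0, t0) \<le> \<bar>x - x0\<bar> + \<bar>t - t0\<bar>"
      using sqrt_sum_squares_le_sum_abs[of "x - x0" "t - t0"] by (simp add: dist_Pair_Pair dist_real_def)
    also have "\<dots> \<le> 2 * r" using that by auto
    finally have *: "dist (x, t) (x0, t0) < d1" "dist (x, t) (x0, t0) < d2" using r d1(1) d2(1) by linarith+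
    have "(x, t) \<in> ?K" using that NK by blast
    with d1(2)[OF _ *(1)] d2(2)[OF _ *(2)] m e l(2)
    show "l x t > 0" "l x t \<le> l x0 t0 + m" "E x t \<ge> 3 * e" by (auto simp: e_def)
  qed
  \<comment> \<open>The slope of the tilt satisfies \<open>c (1 + l) \<le> e\<close> on the quadrant; the approximation error \<open>e'\<close> is so
    small that on the left and lower edges the tilt, which is at least \<open>c r\<close> there, outweighs it.\<close>
  define c where "c = e / (l x0 t0 + m + 1)"
  have c: "c > 0" "c * (l x0 t0 + m + 1) = e" using e m l(2) by (auto simp: c_def)
  define e' where "e' = min (e / 2) (c * r / 4)"
  have e': "e' > 0" "e' \<le> e / 2" "e' \<le> c * r / 4" using e c r by (auto simp: e'_def)
  obtain v vx vt where v: "partials_on ?K v vx vt"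
    "\<And>x t. (x, t) \<in> ?K \<Longrightarrow> \<bar>v x t - u x t\<bar> \<le> e'"
    "\<And>x t. (x, t) \<in> ?K \<Longrightarrow> \<bar>vt x t + l x t * vx x t - E x t\<bar> \<le> e'"
    using tr[unfolded transport_on_def, rule_format, OF e'(1)] by fast
  define w where "w = (\<lambda>x t. v x t - (c * x + c * t))"
  have w: "partials_on ?N w (\<lambda>x t. vx x t - (c * 1 + c * 0)) (\<lambda>x t. vt x t - (c * 0 + c * 1))"
    unfolding w_def
    by (intro partials_on_diff partials_on_subset[OF v(1) NK] partials_on_add partials_on_cmult
        partials_on_space partials_on_time) (auto intro!: derivative_eq_intros)
  have "\<exists>p\<in>?N. \<forall>q\<in>?N. w (fst p) (snd p) \<le> w (fst q) (snd q)"
    using partials_on_continuous[OF w] r(1)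
    by (intro continuous_attains_inf compact_Times compact_Icc) auto
  then obtain x1 t1 where p1: "(x1, t1) \<in> ?N" "\<And>x t. (x, t) \<in> ?N \<Longrightarrow> w x1 t1 \<le> w x t"
    by fastforce
  have "(x1, t1) \<in> ?K" using p1(1) NK by blast
  have "v x0 t0 \<le> e'" using v(2)[OF K0] u0 by simp
  moreover have "v x1 t1 \<ge> - e'"
    using v(2)[OF \<open>(x1, t1) \<in> ?K\<close>] nonneg[of x1 t1] \<open>(x1, t1) \<in> ?K\<close> p1(1) by auto
  moreover have "v x1 t1 - (c * x1 + c * t1) \<le> v x0 t0 - (c * x0 + c * t0)"
    using p1(2)[of x0 t0] r(1) by (auto simp: w_def)
  ultimately have "c * (x0 - x1) + c * (t0 - t1) \<le> 2 * e'"
    by (simp add: algebra_simps)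
  also have "\<dots> < c * r" using e' c r by auto
  finally have "c * ((x0 - x1) + (t0 - t1)) < c * r" by (simp add: algebra_simps)
  then have lt: "(x0 - x1) + (t0 - t1) < r" using c(1) by simp
  have edge: "x1 > x0 - r" "t1 > t0 - r" using lt p1(1) by auto
  \<comment> \<open>One step from the minimum in the direction \<open>- (l, 1)\<close> stays in the quadrant.\<close>
  define L where "L = l x1 t1"
  have L: "L > 0" using near(1)[OF p1(1)] by (simp add: L_def)
  define s0 where "s0 = min ((x1 - (x0 - r)) / L) (t1 - (t0 - r))"
  have s0: "s0 > 0" using edge L by (auto simp: s0_def)
  have backwards: "(x1 - L * s, t1 - s) \<in> ?N" if "s \<in> {0..s0}" for s
  proof -
    have K: "x1 \<le> x0" "t1 \<le> t0" using p1(1) by auto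
    have "L * s \<le> L * ((x1 - (x0 - r)) / L)" using that L by (intro mult_left_mono) (auto simp: s0_def)
    moreover have "0 \<le> L * s" using L that by auto
    moreover have "s \<le> t1 - (t0 - r)" "0 \<le> s" using that by (auto simp: s0_def)
    moreover have "L * ((x1 - (x0 - r)) / L) = x1 - (x0 - r)" using L by simp
    ultimately show ?thesis using K unfolding mem_Sigma_iff atLeastAtMost_iff by linarith
  qed
  have sub: "(\<lambda>s. (x1 - L * s, t1 - s)) ` {0..s0} \<subseteq> ?N"
    using backwards by (rule image_subsetI)
  have der: "((\<lambda>s. w (x1 - L * s) (t1 - s)) has_real_derivative
      - ((vt x1 t1 - c) + L * (vx x1 t1 - c))) (at 0 within {0..s0})"
  proof -
    have 1: "((\<lambda>s. (x1 - L * s, t1 - s)) has_derivative (\<lambda>h. (- L * h, - h))) (at 0 within {0..s0})"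
      by (auto intro!: derivative_eq_intros)
    have 2: "((\<lambda>p. w (fst p) (snd p)) has_derivative (\<lambda>h. (vx x1 t1 - c) * fst h + (vt x1 t1 - c) * snd h))
        (at (x1 - L * 0, t1 - 0) within (\<lambda>s. (x1 - L * s, t1 - s)) ` {0..s0})"
      using has_derivative_subset[OF partials_onD[OF w p1(1)] sub] by simp
    show ?thesis
      unfolding has_field_derivative_def using has_derivative_in_compose[OF 1 2, unfolded fst_conv snd_conv]
      by (rule has_derivative_eq_rhs) (auto simp: fun_eq_iff algebra_simps)
  qed
  have "0 \<le> - ((vt x1 t1 - c) + L * (vx x1 t1 - c))"
  proof (rule tendsto_lowerbound[OF der[unfolded has_field_derivative_iff]])
    show "\<forall>\<^sub>F s in at 0 within {0..s0}. 0 \<le> (w (x1 - L * s) (t1 - s) - w (x1 - L * 0) (t1 - 0)) / (s - 0)"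
      unfolding eventually_at_filter using p1(2)[OF backwards] by (intro always_eventually) auto
    show "at 0 within {0..s0} \<noteq> bot" using s0 by (simp add: at_within_Icc_at_right)
  qed
  moreover have "vt x1 t1 + L * vx x1 t1 \<ge> E x1 t1 - e'"
    using v(3)[OF \<open>(x1, t1) \<in> ?K\<close>] by (simp add: L_def)
  moreover have "E x1 t1 \<ge> 3 * e" by (rule near(3)[OF p1(1)])
  moreover have "c * (1 + L) \<le> e"
    using near(2)[OF p1(1)] c(1) unfolding c(2)[symmetric] L_def by (intro mult_left_mono) auto
  ultimately show False using e' e by (simp add: algebra_simps)
qed

text \<open>
  A time-minimal point among the zeros of the functions in \<open>F\<close> is a touching point for one of them.
  The hypothesis \<open>touch\<close> may use the signs of all functions at that point; this is how coupled bounds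
  are proved simultaneously.
\<close>

lemma transport_system_positive:
  assumes fin: "finite F"
    and tr: "\<And>u l E. (u, l, E) \<in> F \<Longrightarrow> transport_on ({a..b} \<times> {0..T}) l u E"
    and cont: "\<And>u l E. (u, l, E) \<in> F \<Longrightarrow> continuous_on ({a..b} \<times> {0..T}) (\<lambda>p. u (fst p) (snd p)) \<and>
       continuous_on ({a..b} \<times> {0..T}) (\<lambda>p. l (fst p) (snd p)) \<and> continuous_on ({a..b} \<times> {0..T}) (\<lambda>p. E (fst p) (snd p))"
    and bdry: "\<And>u l E x t. (u, l, E) \<in> F \<Longrightarrow> x \<in> {a..b} \<Longrightarrow> t \<in> {0..T} \<Longrightarrow> x = a \<or> t = 0 \<Longrightarrow> u x t > 0"
    and touch: "\<And>u l E x t. (u, l, E) \<in> F \<Longrightarrow> x \<in> {a..b} \<Longrightarrow> t \<in> {0..T} \<Longrightarrow> u x t = 0 \<Longrightarrow>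
       (\<And>u' l' E'. (u', l', E') \<in> F \<Longrightarrow> u' x t \<ge> 0) \<Longrightarrow> l x t > 0 \<and> E x t > 0"
    and mem: "(u, l, E) \<in> F" "x \<in> {a..b}" "t \<in> {0..T}"
  shows "u x t > 0"
proof (rule ccontr)
  assume neg: "\<not> u x t > 0"
  let ?K = "{a..b} \<times> {0..T}"
  define Z where "Z = (\<Union>(u, l, E)\<in>F. {p \<in> ?K. u (fst p) (snd p) \<le> 0})"
  have "compact {p \<in> ?K. u (fst p) (snd p) \<le> 0}" if "(u, l, E) \<in> F" for u l E
  proof -
    have "continuous_on ?K (\<lambda>p. u (fst p) (snd p))"
      using cont[OF that] by simp
    then have "closed (?K \<inter> (\<lambda>p. u (fst p) (snd p)) -` {..0})"
      by (intro continuous_closed_preimage compact_imp_closed compact_Times compact_Icc closed_atMost)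
    then have "compact (?K \<inter> (?K \<inter> (\<lambda>p. u (fst p) (snd p)) -` {..0}))"
      by (intro compact_Int_closed compact_Times compact_Icc)
    moreover have "?K \<inter> (?K \<inter> (\<lambda>p. u (fst p) (snd p)) -` {..0}) = {p \<in> ?K. u (fst p) (snd p) \<le> 0}"
      by blast
    ultimately show ?thesis by simp
  qed
  then have "compact Z"
    unfolding Z_def by (intro compact_UN[OF fin]) (auto simp only: split: prod.split)
  moreover have xt: "(x, t) \<in> Z" unfolding Z_def using mem neg by (intro UN_I[OF mem(1)]) simp
  ultimately obtain z where z: "z \<in> Z" "\<And>y. y \<in> Z \<Longrightarrow> snd z \<le> snd y"
    using continuous_attains_inf[of Z snd] continuous_on_snd[OF continuous_on_id] by blast
  obtain x0 t0 where z_eq: "z = (x0, t0)" by force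
  obtain u0 l0 E0 where F0: "(u0, l0, E0) \<in> F" and K0: "x0 \<in> {a..b}" "t0 \<in> {0..T}" and le0: "u0 x0 t0 \<le> 0"
    using z(1) by (auto simp: Z_def z_eq)
  have before: "u' y s > 0" if "(u', l', E') \<in> F" "y \<in> {a..b}" "0 \<le> s" "s < t0" for u' l' E' y s
  proof (rule ccontr)
    assume "\<not> u' y s > 0"
    then have "(y, s) \<in> Z" unfolding Z_def using that K0 by (intro UN_I[OF that(1)]) auto
    from z(2)[OF this] that(4) show False by (simp add: z_eq)
  qed
  have "x0 \<noteq> a \<and> t0 \<noteq> 0" using bdry[OF F0 K0] le0 by auto
  then have pt: "a < x0" "x0 \<le> b" "0 < t0" "t0 \<le> T" using K0 by auto
  have upto: "u' y s \<ge> 0" if u': "(u', l', E') \<in> F" "y \<in> {a..b}" and s: "0 \<le> s" "s \<le> t0" for u' l' E' y s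
  proof (cases "s = t0")
    case False
    then show ?thesis using before[OF u'] s by force
  next
    case True
    have "continuous_on {0..T} (\<lambda>s. u' y s)"
      using cont[OF u'(1)] u'(2)
      by (intro continuous_on_compose2[where g = "\<lambda>p. u' (fst p) (snd p)" and f = "\<lambda>s. (y, s)" and t = ?K, simplified])
         (auto intro!: continuous_intros)
    then have "((\<lambda>s. u' y s) \<longlongrightarrow> u' y t0) (at t0 within {0..T})"
      using K0 by (auto simp: continuous_on_def)
    then have "((\<lambda>s. u' y s) \<longlongrightarrow> u' y t0) (at t0 within {0..<t0})"
      using K0 by (elim tendsto_within_subset) auto
    moreover have "at t0 within {0..<t0} \<noteq> bot"
      using pt by (simp add: at_within_eq_bot_iff)
    moreover have "\<forall>\<^sub>F s in at t0 within {0..<t0}. 0 \<le> u' y s"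
      using before[OF u'] by (auto simp: eventually_at_filter intro!: always_eventually less_imp_le)
    ultimately show ?thesis unfolding True by (intro tendsto_lowerbound)
  qed
  have zero: "u0 x0 t0 = 0" using upto[OF F0 K0(1), of t0] pt le0 by auto
  have pos: "l0 x0 t0 > 0" "E0 x0 t0 > 0"
    using touch[OF F0 K0 zero] upto[OF _ K0(1), of _ _ _ t0] pt by auto
  have "E0 x0 t0 \<le> 0"
    using cont[OF F0] pos(1) upto[OF F0] pt zero by (intro transport_on_touching[OF tr[OF F0]]) auto
  with pos show False by simp
qed

section \<open>Algebra of the speeds and of the source\<close>

lemma lam_order:
  assumes "1 < \<gamma>" "\<gamma> < 3" "0 < s" "s \<le> r"
  shows "0 < lam1 \<gamma> s r" "lam1 \<gamma> s r \<le> lam2 \<gamma> s r"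
    "lam2 \<gamma> s r - lam1 \<gamma> s r = (\<gamma> - 1) / 2 * (r - s)"
proof -
  show eq: "lam2 \<gamma> s r - lam1 \<gamma> s r = (\<gamma> - 1) / 2 * (r - s)"
    by (simp add: lam1_def lam2_def field_simps)
  have "0 \<le> (\<gamma> - 1) / 2 * (r - s)" using assms by simp
  then show "lam1 \<gamma> s r \<le> lam2 \<gamma> s r" using eq by linarith
  show "0 < lam1 \<gamma> s r" using assms by (auto simp: lam1_def intro!: add_pos_pos)
qed

lemma source_nonneg:
  "1 < \<gamma> \<Longrightarrow> 0 \<le> k \<Longrightarrow> 0 < s \<Longrightarrow> s \<le> r \<Longrightarrow> 0 \<le> source \<gamma> k s r"
  by (auto simp: source_def intro!: mult_nonneg_nonneg power_mono)

text \<open>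
  The factor \<open>(1 + d)\<^sup>2 - 1\<close> is at most \<open>3 d\<close>, and \<open>(\<gamma> - 1) / 8 \<le> 1 / 4\<close>.
\<close>

lemma source_le_of_close:
  assumes \<gamma>: "1 < \<gamma>" "\<gamma> < 3" and k: "0 \<le> k" and sr: "0 < s" "s \<le> r" "r \<le> (1 + d) * s" and d: "0 \<le> d" "d \<le> 1"
  shows "source \<gamma> k s r \<le> d * (k * s\<^sup>2)"
proof -
  have "r\<^sup>2 \<le> ((1 + d) * s)\<^sup>2" using sr by (intro power_mono) auto
  also have "\<dots> = s\<^sup>2 + (2 * d + d * d) * s\<^sup>2" by (simp add: power2_eq_square algebra_simps)
  also have "\<dots> \<le> s\<^sup>2 + (2 * d + d * 1) * s\<^sup>2"
    using d by (intro add_left_mono mult_right_mono mult_left_mono) auto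
  finally have "r\<^sup>2 \<le> s\<^sup>2 + (2 * d + d * 1) * s\<^sup>2" .
  moreover have "0 \<le> d * s\<^sup>2" using d by simp
  ultimately have "r\<^sup>2 - s\<^sup>2 \<le> 4 * (d * s\<^sup>2)" by (simp add: algebra_simps)
  moreover have "s\<^sup>2 \<le> r\<^sup>2" using sr by (intro power_mono) auto
  ultimately have "(\<gamma> - 1) / 8 * k * (r\<^sup>2 - s\<^sup>2) \<le> (1 / 4 * k) * (4 * (d * s\<^sup>2))"
    using \<gamma> k by (intro mult_mono) auto
  then show ?thesis by (simp add: source_def algebra_simps)
qed

text \<open>
  Multiplied by \<open>l2\<close>, the left side of the conclusion is \<open>q (l2 - l1) - l1 g\<close>.
\<close>

lemma derivative_along_slower_curve:
  fixes l1 l2 q z g \<eta> :: real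
  assumes l: "0 < l1" "l1 \<le> l2" and eq: "q + l2 * z = - g" and g: "0 \<le> g" and q: "q \<le> \<eta>" "0 \<le> \<eta>"
  shows "q + l1 * z \<le> \<eta>"
proof -
  have "l2 * (q + l1 * z) = q * (l2 - l1) + l1 * (q + l2 * z)" by (simp add: algebra_simps)
  also have "\<dots> \<le> \<eta> * (l2 - l1) + 0"
    unfolding eq using l g q by (intro add_mono mult_right_mono mult_nonneg_nonpos) auto
  also have "\<dots> \<le> l2 * \<eta>" using l q by (simp add: algebra_simps)
  finally show ?thesis using l by simp
qed

lemma derivative_along_faster_curve:
  fixes l1 l2 p w g :: real
  assumes l: "0 < l1" "l1 \<le> l2" and eq: "p + l1 * w = g" and g: "0 \<le> g" and p: "p \<le> 0"
  shows "0 \<le> p + l2 * w"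
proof -
  have "l1 * (p + l2 * w) = - p * (l2 - l1) + l2 * (p + l1 * w)" by (simp add: algebra_simps)
  also have "\<dots> \<ge> 0" unfolding eq using l g p by (intro add_nonneg_nonneg mult_nonneg_nonneg) auto
  finally show ?thesis using l by (simp add: zero_le_mult_iff)
qed

text \<open>
  At a point with \<open>S\<^sub>t = 0\<close> the derivative \<open>- (g\<^sub>t - (\<lambda>\<^sub>1)\<^sub>t S\<^sub>x)\<close> of \<open>- S\<^sub>t\<close> reduces to \<open>q\<close> times
  \<open>(3 - \<gamma>) / 4 w - (\<gamma> - 1) / 4 k r\<close>. This factor is nonpositive, because \<open>(3 - \<gamma>) / 4 r \<le> \<lambda>\<^sub>1\<close> and
  \<open>\<lambda>\<^sub>1 w = g \<le> (\<gamma> - 1) / 8 k r\<^sup>2\<close>. The value \<open>\<eta>\<close> stands for the perturbation that makes inequalities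
  strict; its effect is linear in \<open>\<eta>\<close> with a factor that depends only on the bound \<open>B\<close>.
\<close>

lemma barrier_S_t:
  fixes \<gamma> s r k w p q \<eta> B :: real
  assumes \<gamma>: "1 < \<gamma>" "\<gamma> < 3" and sr: "0 < s" "s < r" and k: "0 \<le> k"
    and w: "p + lam1 \<gamma> s r * w = source \<gamma> k s r"
    and p: "p = \<eta>" and q: "q \<le> \<eta>" and \<eta>: "0 < \<eta>"
    and B: "r \<le> B" "k \<le> B" "\<bar>w\<bar> \<le> B"
  shows "0 \<le> - ((\<gamma> - 1) / 4 * k * (r * q - s * p) - ((\<gamma> + 1) / 4 * p + (3 - \<gamma>) / 4 * q) * w)
     + (B\<^sup>2 + 2 * B) * \<eta>"
proof -
  have B0: "B > 0" using B sr by linarith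
  define c where "c = (3 - \<gamma>) / 4 * w - (\<gamma> - 1) / 4 * (k * r)"
  have kr: "0 \<le> (\<gamma> - 1) / 8 * (k * r)" using \<gamma> k sr by simp
  have c_nonpos: "c \<le> 0"
  proof (cases "w \<le> 0")
    case True
    then have "(3 - \<gamma>) / 4 * w \<le> 0" using \<gamma> by (intro mult_nonneg_nonpos) auto
    then show ?thesis using kr unfolding c_def by linarith
  next
    case False
    have "(3 - \<gamma>) / 4 * r \<le> lam1 \<gamma> s r" using \<gamma> sr by (simp add: lam1_def)
    then have "(3 - \<gamma>) / 4 * r * w \<le> lam1 \<gamma> s r * w" using False by (intro mult_right_mono) auto
    also have "\<dots> \<le> source \<gamma> k s r" using w p \<eta> by simp
    also have "\<dots> \<le> (\<gamma> - 1) / 8 * k * r\<^sup>2"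
      unfolding source_def using \<gamma> k by (intro mult_left_mono) auto
    finally have "r * ((3 - \<gamma>) / 4 * w) \<le> r * ((\<gamma> - 1) / 8 * (k * r))"
      by (simp add: power2_eq_square mult_ac)
    then have "(3 - \<gamma>) / 4 * w \<le> (\<gamma> - 1) / 8 * (k * r)" using sr by simp
    then show ?thesis using kr unfolding c_def by linarith
  qed
  have "\<bar>(3 - \<gamma>) / 4 * w\<bar> \<le> 1 / 2 * B" unfolding abs_mult using B \<gamma> by (intro mult_mono) auto
  moreover have "(\<gamma> - 1) / 4 * (k * r) \<le> 1 / 2 * (B * B)"
    using B \<gamma> k sr B0 by (intro mult_mono) auto
  ultimately have "- (B\<^sup>2 + B) \<le> c"
    using B0 zero_le_square[of B] unfolding c_def power2_eq_square by linarith
  then have "\<eta> * - (B\<^sup>2 + B) \<le> \<eta> * c" using \<eta> by (intro mult_left_mono) auto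
  also have "\<dots> \<le> q * c" using c_nonpos q by (intro mult_right_mono_neg)
  finally have q_part: "\<eta> * - (B\<^sup>2 + B) \<le> q * c" .
  have "\<bar>(\<gamma> + 1) / 4 * w\<bar> \<le> 1 * B" unfolding abs_mult using B \<gamma> by (intro mult_mono) auto
  then have p_part: "\<eta> * - B \<le> \<eta> * ((\<gamma> + 1) / 4 * w)" using \<eta> by (intro mult_left_mono) auto
  have k_part: "0 \<le> (\<gamma> - 1) / 4 * (k * s) * \<eta>" using \<gamma> k sr \<eta> by simp
  have "- ((\<gamma> - 1) / 4 * k * (r * q - s * p) - ((\<gamma> + 1) / 4 * p + (3 - \<gamma>) / 4 * q) * w)
       + (B\<^sup>2 + 2 * B) * \<eta>
     = (q * c - \<eta> * - (B\<^sup>2 + B)) + (\<eta> * ((\<gamma> + 1) / 4 * w) - \<eta> * - B) + (\<gamma> - 1) / 4 * (k * s) * \<eta>"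
    unfolding p c_def by (simp add: algebra_simps add_divide_distrib diff_divide_distrib)
  also have "\<dots> \<ge> 0" using q_part p_part k_part by (intro add_nonneg_nonneg) auto
  finally show ?thesis .
qed

text \<open>
  At a point with \<open>R\<^sub>t = 0\<close> the derivative of \<open>- R\<^sub>t\<close> is \<open>- c p\<close> with \<open>c = (\<gamma> - 1) / 4 k s - (3 - \<gamma>) / 4 z\<close>,
  and \<open>z = R\<^sub>x = - g / \<lambda>\<^sub>2 \<le> 0\<close>, hence \<open>c \<ge> 0\<close>.
\<close>

lemma barrier_R_t:
  fixes \<gamma> s r k z p q \<eta> B :: real
  assumes \<gamma>: "1 < \<gamma>" "\<gamma> < 3" and sr: "0 < s" "s < r" and k: "0 \<le> k"
    and z: "q + lam2 \<gamma> s r * z = - source \<gamma> k s r"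
    and p: "p \<le> \<eta>" and q: "q = \<eta>" and \<eta>: "0 < \<eta>"
    and B: "r \<le> B" "k \<le> B" "\<bar>z\<bar> \<le> B"
  shows "0 \<le> (\<gamma> - 1) / 4 * k * (r * q - s * p) + ((3 - \<gamma>) / 4 * p + (\<gamma> + 1) / 4 * q) * z
     + (B\<^sup>2 + 2 * B) * \<eta>"
proof -
  have B0: "B > 0" using B sr by linarith
  have l: "0 < lam2 \<gamma> s r" using \<gamma> sr by (auto simp: lam2_def intro!: add_pos_pos)
  have "0 \<le> source \<gamma> k s r"
    using \<gamma> sr k by (auto simp: source_def intro!: mult_nonneg_nonneg power_mono)
  then have "lam2 \<gamma> s r * z < 0" using z q \<eta> by linarith
  then have z0: "z < 0" using l by (simp add: mult_less_0_iff)
  define c where "c = (\<gamma> - 1) / 4 * (k * s) - (3 - \<gamma>) / 4 * z"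
  have 1: "(3 - \<gamma>) / 4 * z \<le> 0" using \<gamma> z0 by (intro mult_nonneg_nonpos) auto
  have c0: "0 \<le> c"
    unfolding c_def using 1 \<gamma> k sr by (smt (verit) mult_nonneg_nonneg divide_nonneg_nonneg)
  have "(\<gamma> - 1) / 4 * (k * s) \<le> 1 * (B * B)" using B \<gamma> k sr B0 by (intro mult_mono) auto
  moreover have "\<bar>(3 - \<gamma>) / 4 * z\<bar> \<le> 1 * B" unfolding abs_mult using B \<gamma> by (intro mult_mono) auto
  ultimately have "c \<le> B\<^sup>2 + B" unfolding c_def power2_eq_square by linarith
  then have "c * p \<le> (B\<^sup>2 + B) * \<eta>"
    using mult_left_mono[OF p c0] mult_right_mono[of c "B\<^sup>2 + B" \<eta>] \<eta> by linarith
  moreover have "0 \<le> (\<gamma> - 1) / 4 * (k * r) * \<eta>" using \<gamma> k sr \<eta> by simp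
  moreover have "- B * \<eta> \<le> (\<gamma> + 1) / 4 * z * \<eta>"
  proof -
    have "\<bar>(\<gamma> + 1) / 4 * z\<bar> \<le> 1 * B" unfolding abs_mult using B \<gamma> by (intro mult_mono) auto
    then show ?thesis using \<eta> by (intro mult_right_mono) auto
  qed
  ultimately show ?thesis unfolding q c_def
    by (simp add: algebra_simps add_divide_distrib diff_divide_distrib)
qed

section \<open>The invariant region on a rectangle\<close>

lemma compact_positive_lower_bound:
  fixes f :: "'a::topological_space \<Rightarrow> real"
  assumes "compact C" "continuous_on C f" "\<And>p. p \<in> C \<Longrightarrow> 0 < f p"
  obtains c where "0 < c" "\<And>p. p \<in> C \<Longrightarrow> c < f p"
proof (cases "C = {}")
  case True
  then show ?thesis by (intro that[of 1]) auto
next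
  case False
  then obtain q where "q \<in> C" "\<forall>p\<in>C. f q \<le> f p"
    using continuous_attains_inf[OF assms(1) _ assms(2)] by blast
  then show ?thesis using assms(3)[of q] by (intro that[of "f q / 2"]) force+
qed

text \<open>
  The maximum principle is applied to four functions: \<open>S\<close> minus a slowly decreasing positive level,
  \<open>R - S\<close> minus an exponentially decaying level, and \<open>\<eta> e\<^sup>L\<^sup>t - S\<^sub>t\<close>, \<open>\<eta> e\<^sup>L\<^sup>t - R\<^sub>t\<close> for every \<open>\<eta> > 0\<close>.
  The level of \<open>R - S\<close> decays because \<open>R - S\<close> satisfies a linear homogeneous equation along second
  characteristics, with a coefficient bounded by \<open>A\<close>; the factor \<open>e\<^sup>L\<^sup>t\<close> absorbs the error terms of the
  two barrier lemmas.
\<close>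

lemma rectangle_invariants:
  fixes \<gamma> a b T :: real and k k' :: "real \<Rightarrow> real" and S R Sx St Rx Rt :: "real \<Rightarrow> real \<Rightarrow> real"
  assumes \<gamma>: "1 < \<gamma>" "\<gamma> < 3" and T: "0 < T"
    and S: "has_C1_partials ({a..b} \<times> {0..}) S Sx St"
    and R: "has_C1_partials ({a..b} \<times> {0..}) R Rx Rt"
    and k: "\<And>x. x \<in> {a..b} \<Longrightarrow> (k has_real_derivative k' x) (at x within {a..b})"
    and k_nonneg: "\<And>x. x \<in> {a..b} \<Longrightarrow> 0 \<le> k x"
    and eqS: "\<And>x t. x \<in> {a..b} \<Longrightarrow> 0 \<le> t \<Longrightarrow>
       St x t + lam1 \<gamma> (S x t) (R x t) * Sx x t = source \<gamma> (k x) (S x t) (R x t)"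
    and eqR: "\<And>x t. x \<in> {a..b} \<Longrightarrow> 0 \<le> t \<Longrightarrow>
       Rt x t + lam2 \<gamma> (S x t) (R x t) * Rx x t = - source \<gamma> (k x) (S x t) (R x t)"
    and bdry: "\<And>x t. x \<in> {a..b} \<Longrightarrow> 0 \<le> t \<Longrightarrow> x = a \<or> t = 0 \<Longrightarrow>
       0 < S x t \<and> S x t < R x t \<and> St x t \<le> 0 \<and> Rt x t \<le> 0"
    and xt: "x \<in> {a..b}" "t \<in> {0..T}"
  shows "0 < S x t \<and> S x t < R x t \<and> St x t \<le> 0 \<and> Rt x t \<le> 0"
proof -
  let ?K = "{a..b} \<times> {0..T}" and ?D = "{a..b} \<times> {0..}"
  have KD: "?K \<subseteq> ?D" by auto
  define l1 where "l1 = (\<lambda>x t. lam1 \<gamma> (S x t) (R x t))"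
  define l2 where "l2 = (\<lambda>x t. lam2 \<gamma> (S x t) (R x t))"
  define g where "g = (\<lambda>x t. source \<gamma> (k x) (S x t) (R x t))"
  define l1t where "l1t = (\<lambda>x t. (\<gamma> + 1) / 4 * St x t + (3 - \<gamma>) / 4 * Rt x t)"
  define l2t where "l2t = (\<lambda>x t. (3 - \<gamma>) / 4 * St x t + (\<gamma> + 1) / 4 * Rt x t)"
  define gt where "gt = (\<lambda>x t. (\<gamma> - 1) / 4 * k x * (R x t * Rt x t - S x t * St x t))"
  have pdS: "partials_on ?D S Sx St" and pdR: "partials_on ?D R Rx Rt"
    using S R by (auto dest: has_C1_partials_imp_partials_on)
  have pdk: "partials_on ?D (\<lambda>x t. k x) (\<lambda>x t. k' x) (\<lambda>x t. 0)"
    using k by (rule partials_on_space)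
  have pdl1: "partials_on ?D l1 (\<lambda>x t. (\<gamma> + 1) / 4 * Sx x t + (3 - \<gamma>) / 4 * Rx x t) l1t"
    unfolding l1_def l1t_def lam1_def by (intro partials_on_add partials_on_cmult pdS pdR)
  have pdl2: "partials_on ?D l2 (\<lambda>x t. (3 - \<gamma>) / 4 * Sx x t + (\<gamma> + 1) / 4 * Rx x t) l2t"
    unfolding l2_def l2t_def lam2_def by (intro partials_on_add partials_on_cmult pdS pdR)
  have pdg: "partials_on ?D g (\<lambda>x t. (\<gamma> - 1) / 8 *
      (k' x * (R x t * R x t - S x t * S x t) + k x * (2 * (R x t * Rx x t) - 2 * (S x t * Sx x t)))) gt"
    by (rule partials_on_eqI[OF partials_on_cmult[OF partials_on_mult[OF pdk partials_on_diff[OF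
          partials_on_mult[OF pdR pdR] partials_on_mult[OF pdS pdS]]], of "(\<gamma> - 1) / 8"]])
       (auto simp: g_def gt_def source_def algebra_simps power2_eq_square add_divide_distrib diff_divide_distrib)
  note cont_D = partials_on_continuous[OF pdS] partials_on_continuous[OF pdR] partials_on_continuous[OF pdk]
    partials_on_continuous[OF pdl1] partials_on_continuous[OF pdl2] partials_on_continuous[OF pdg]
  have cont_D': "continuous_on ?D (\<lambda>p. Sx (fst p) (snd p))" "continuous_on ?D (\<lambda>p. St (fst p) (snd p))"
    "continuous_on ?D (\<lambda>p. Rx (fst p) (snd p))" "continuous_on ?D (\<lambda>p. Rt (fst p) (snd p))"
    using S R by (auto simp: has_C1_partials_def case_prod_unfold)
  have cont_t: "continuous_on ?D (\<lambda>p. l1t (fst p) (snd p))" "continuous_on ?D (\<lambda>p. l2t (fst p) (snd p))"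
    "continuous_on ?D (\<lambda>p. gt (fst p) (snd p))"
    unfolding l1t_def l2t_def gt_def by (intro continuous_intros cont_D cont_D')+
  note cont_K = cont_D[THEN continuous_on_subset, OF KD] cont_D'[THEN continuous_on_subset, OF KD]
    cont_t[THEN continuous_on_subset, OF KD]

  obtain B where B: "0 < B" "\<And>x t. x \<in> {a..b} \<Longrightarrow> 0 \<le> t \<Longrightarrow> t \<le> T \<Longrightarrow>
      \<bar>R x t\<bar> \<le> B \<and> \<bar>S x t\<bar> \<le> B \<and> \<bar>k x\<bar> \<le> B \<and> \<bar>Sx x t\<bar> \<le> B \<and> \<bar>Rx x t\<bar> \<le> B"
  proof -
    obtain B1 where B1: "0 < B1" "\<And>x t. x \<in> {a..b} \<Longrightarrow> 0 \<le> t \<Longrightarrow> t \<le> T \<Longrightarrow> \<bar>S x t\<bar> \<le> B1"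
      using continuous_on_rectangle_bound[OF cont_D(1)] by blast
    obtain B2 where B2: "0 < B2" "\<And>x t. x \<in> {a..b} \<Longrightarrow> 0 \<le> t \<Longrightarrow> t \<le> T \<Longrightarrow> \<bar>R x t\<bar> \<le> B2"
      using continuous_on_rectangle_bound[OF cont_D(2)] by blast
    obtain B3 where B3: "0 < B3" "\<And>x t. x \<in> {a..b} \<Longrightarrow> 0 \<le> t \<Longrightarrow> t \<le> T \<Longrightarrow> \<bar>k x\<bar> \<le> B3"
      using continuous_on_rectangle_bound[OF cont_D(3)] by blast
    obtain B4 where B4: "0 < B4" "\<And>x t. x \<in> {a..b} \<Longrightarrow> 0 \<le> t \<Longrightarrow> t \<le> T \<Longrightarrow> \<bar>Sx x t\<bar> \<le> B4"
      using continuous_on_rectangle_bound[OF cont_D'(1)] by blast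
    obtain B5 where B5: "0 < B5" "\<And>x t. x \<in> {a..b} \<Longrightarrow> 0 \<le> t \<Longrightarrow> t \<le> T \<Longrightarrow> \<bar>Rx x t\<bar> \<le> B5"
      using continuous_on_rectangle_bound[OF cont_D'(3)] by blast
    show thesis
      by (rule that[of "B1 + B2 + B3 + B4 + B5"])
         (use B1 B2 B3 B4 B5 in \<open>fastforce intro: order_trans\<close>)+
  qed

  define \<Gamma> where "\<Gamma> = {a} \<times> {0..T} \<union> {a..b} \<times> {0}"
  have \<Gamma>: "compact \<Gamma>"
    unfolding \<Gamma>_def by (intro compact_Un compact_Times) auto
  have ab: "a \<le> b" using xt by auto
  then have \<Gamma>K: "\<Gamma> \<subseteq> ?K" using T unfolding \<Gamma>_def by auto
  have \<Gamma>_bdry: "0 < S (fst p) (snd p)" "0 < R (fst p) (snd p) - S (fst p) (snd p)" if "p \<in> \<Gamma>" for p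
    using bdry[of "fst p" "snd p"] that T ab unfolding \<Gamma>_def by auto
  obtain s0 where s0: "0 < s0" "\<And>p. p \<in> \<Gamma> \<Longrightarrow> s0 < S (fst p) (snd p)"
    using compact_positive_lower_bound[OF \<Gamma> continuous_on_subset[OF cont_K(1) \<Gamma>K] \<Gamma>_bdry(1)] by blast
  obtain d0 where d0: "0 < d0" "\<And>p. p \<in> \<Gamma> \<Longrightarrow> d0 < R (fst p) (snd p) - S (fst p) (snd p)"
    using compact_positive_lower_bound[OF \<Gamma> continuous_on_diff[OF
        continuous_on_subset[OF cont_K(2) \<Gamma>K] continuous_on_subset[OF cont_K(1) \<Gamma>K]] \<Gamma>_bdry(2)] by blast
  define A where "A = B\<^sup>2 + B + 1"
  define L where "L = B\<^sup>2 + 2 * B + 1"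
  have AL: "A > 0" "L > 0" using B(1) by (auto simp: A_def L_def add_pos_pos)

  have perturbed: "S x t > s0 * (1 - t / (2 * T)) \<and> R x t - S x t > d0 * exp (- A * t) \<and>
      St x t < \<eta> * exp (L * t) \<and> Rt x t < \<eta> * exp (L * t)"
    if \<eta>: "0 < \<eta>" for \<eta>
  proof -
    define U1 where "U1 = (\<lambda>x t. S x t - s0 * (1 - t / (2 * T)))"
    define U2 where "U2 = (\<lambda>x t. R x t - S x t - d0 * exp (- A * t))"
    define U3 where "U3 = (\<lambda>x t. \<eta> * exp (L * t) - St x t)"
    define U4 where "U4 = (\<lambda>x t. \<eta> * exp (L * t) - Rt x t)"
    define E1 where "E1 = (\<lambda>x t. g x t + s0 / (2 * T))"
    define E2 where "E2 = (\<lambda>x t. A * d0 * exp (- A * t) - 2 * g x t - (l2 x t - l1 x t) * Sx x t)"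
    define E3 where "E3 = (\<lambda>x t. L * \<eta> * exp (L * t) - (gt x t - l1t x t * Sx x t))"
    define E4 where "E4 = (\<lambda>x t. L * \<eta> * exp (L * t) - (- gt x t - l2t x t * Rx x t))"
    define F where "F = {(U1, l1, E1), (U2, l2, E2), (U3, l1, E3), (U4, l2, E4)}"
    note pdK = partials_on_subset[OF pdS KD] partials_on_subset[OF pdR KD]
    have eqS': "l1 x t * Sx x t = g x t - St x t" if "(x, t) \<in> ?K" for x t
      using eqS[of x t] that by (simp add: l1_def g_def)
    have eqR': "l2 x t * Rx x t = - g x t - Rt x t" if "(x, t) \<in> ?K" for x t
      using eqR[of x t] that by (simp add: l2_def g_def)
    have tr1: "transport_on ?K l1 U1 E1"
    proof (rule partials_on_imp_transport_on)
      show "partials_on ?K U1 (\<lambda>x t. Sx x t - 0) (\<lambda>x t. St x t - s0 * (- (1 / (2 * T))))"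
        unfolding U1_def
        by (intro partials_on_diff pdK partials_on_time) (use T in \<open>auto intro!: derivative_eq_intros\<close>)
      show "E1 x t = (St x t - s0 * (- (1 / (2 * T)))) + l1 x t * (Sx x t - 0)" if "(x, t) \<in> ?K" for x t
        using eqS'[OF that] by (simp add: E1_def)
    qed
    have tr2: "transport_on ?K l2 U2 E2"
    proof (rule partials_on_imp_transport_on)
      show "partials_on ?K U2 (\<lambda>x t. Rx x t - Sx x t - 0) (\<lambda>x t. Rt x t - St x t - d0 * (exp (- A * t) * - A))"
        unfolding U2_def
        by (intro partials_on_diff pdK partials_on_time) (use T in \<open>auto intro!: derivative_eq_intros\<close>)
      show "E2 x t = (Rt x t - St x t - d0 * (exp (- A * t) * - A)) + l2 x t * (Rx x t - Sx x t - 0)"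
        if "(x, t) \<in> ?K" for x t
        using eqR'[OF that] eqS'[OF that] by (simp add: E2_def algebra_simps)
    qed
    have tr3: "transport_on ?K l1 U3 E3"
      unfolding U3_def E3_def
    proof (intro transport_on_diff[of _ _ _ _ St])
      show "transport_on ?K l1 (\<lambda>x t. \<eta> * exp (L * t)) (\<lambda>x t. L * \<eta> * exp (L * t))"
        by (rule partials_on_imp_transport_on[OF partials_on_time[of _ "\<lambda>t. L * \<eta> * exp (L * t)"]])
           (auto intro!: derivative_eq_intros)
      show "transport_on ?K l1 St (\<lambda>x t. gt x t - l1t x t * Sx x t)"
        using transport_on_time_derivative[OF pdS pdl1 pdg cont_D'(1,2) cont_t(1,3), of T] eqS
        by (simp add: l1_def g_def)
    qed
    have tr4: "transport_on ?K l2 U4 E4"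
      unfolding U4_def E4_def
    proof (intro transport_on_diff[of _ _ _ _ Rt])
      show "transport_on ?K l2 (\<lambda>x t. \<eta> * exp (L * t)) (\<lambda>x t. L * \<eta> * exp (L * t))"
        by (rule partials_on_imp_transport_on[OF partials_on_time[of _ "\<lambda>t. L * \<eta> * exp (L * t)"]])
           (auto intro!: derivative_eq_intros)
      show "transport_on ?K l2 Rt (\<lambda>x t. - gt x t - l2t x t * Rx x t)"
      proof (rule transport_on_time_derivative[OF pdR pdl2 _ cont_D'(3,4) cont_t(2)])
        show "partials_on ?D (\<lambda>x t. - 1 * g x t) (\<lambda>x t. - 1 * ((\<gamma> - 1) / 8 *
           (k' x * (R x t * R x t - S x t * S x t) + k x * (2 * (R x t * Rx x t) - 2 * (S x t * Sx x t)))))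
           (\<lambda>x t. - gt x t)"
          by (rule partials_on_eqI[OF partials_on_cmult[OF pdg, of "- 1"]]) auto
        show "continuous_on ?D (\<lambda>p. - gt (fst p) (snd p))" by (intro continuous_on_minus cont_t)
        show "Rt x t + l2 x t * Rx x t = - 1 * g x t" if "x \<in> {a..b}" "0 \<le> t" for x t
          using eqR[OF that] by (simp add: l2_def g_def)
      qed
    qed
    have cont: "continuous_on ?K (\<lambda>p. U1 (fst p) (snd p))" "continuous_on ?K (\<lambda>p. U2 (fst p) (snd p))"
      "continuous_on ?K (\<lambda>p. U3 (fst p) (snd p))" "continuous_on ?K (\<lambda>p. U4 (fst p) (snd p))"
      "continuous_on ?K (\<lambda>p. E1 (fst p) (snd p))" "continuous_on ?K (\<lambda>p. E2 (fst p) (snd p))"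
      "continuous_on ?K (\<lambda>p. E3 (fst p) (snd p))" "continuous_on ?K (\<lambda>p. E4 (fst p) (snd p))"
      unfolding U1_def U2_def U3_def U4_def E1_def E2_def E3_def E4_def
      using T by (intro continuous_intros cont_K; simp)+
    have pos: "u y s > 0" if "(u, l, E) \<in> F" "y \<in> {a..b}" "s \<in> {0..T}" for u l E y s
    proof (rule transport_system_positive[of F, OF _ _ _ _ _ that])
      show "finite F" by (simp add: F_def)
    next
      fix u l E assume "(u, l, E) \<in> F"
      then show "transport_on ?K l u E" using tr1 tr2 tr3 tr4 by (auto simp: F_def)
    next
      fix u l E assume "(u, l, E) \<in> F"
      then show "continuous_on ?K (\<lambda>p. u (fst p) (snd p)) \<and> continuous_on ?K (\<lambda>p. l (fst p) (snd p)) \<and>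
        continuous_on ?K (\<lambda>p. E (fst p) (snd p))"
        using cont cont_K(4,5) by (auto simp: F_def)
    next
      fix u l E y s assume u: "(u, l, E) \<in> F" and y: "y \<in> {a..b}" and s: "s \<in> {0..T}" and ys: "y = a \<or> s = 0"
      have "(y, s) \<in> \<Gamma>" using y s ys by (auto simp: \<Gamma>_def)
      note s0 = s0(1) s0(2)[OF this, simplified] and d0 = d0(1) d0(2)[OF this, simplified]
      have b: "St y s \<le> 0" "Rt y s \<le> 0"
        using bdry[OF y _ ys] s by auto
      have "0 < U1 y s"
      proof -
        have "s0 * (1 - s / (2 * T)) \<le> s0 * 1" using s0(1) s T by (intro mult_left_mono) auto
        then show ?thesis using s0(2) by (simp add: U1_def)
      qed
      moreover have "0 < U2 y s"
      proof -
        have "d0 * exp (- A * s) \<le> d0 * 1" using d0(1) s AL by (intro mult_left_mono) auto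
        then show ?thesis using d0(2) by (simp add: U2_def)
      qed
      moreover have "0 < U3 y s" "0 < U4 y s"
        using b mult_pos_pos[OF \<eta> exp_gt_zero, of "L * s"] by (auto simp: U3_def U4_def)
      ultimately show "0 < u y s" using u by (auto simp: F_def)
    next
      fix u l E y s
      assume u: "(u, l, E) \<in> F" and y: "y \<in> {a..b}" and s: "s \<in> {0..T}" and zero: "u y s = 0"
        and nonneg: "\<And>u' l' E'. (u', l', E') \<in> F \<Longrightarrow> u' y s \<ge> 0"
      define h where "h = \<eta> * exp (L * s)"
      have h0: "0 < h" using \<eta> by (simp add: h_def)
      have U: "0 \<le> U1 y s" "0 \<le> U2 y s" "0 \<le> U3 y s" "0 \<le> U4 y s"
        using nonneg by (auto simp: F_def)
      \<comment> \<open>The speeds are positive at this point because \<open>U1\<close> and \<open>U2\<close> keep \<open>S\<close> and \<open>R - S\<close> positive.\<close>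
      have "s0 / 2 \<le> s0 * (1 - s / (2 * T))" using s0(1) s T by (simp add: field_simps)
      then have S_ge: "s0 / 2 \<le> S y s" using U(1) by (simp add: U1_def)
      then have S0: "0 < S y s" using s0(1) by simp
      have SR: "S y s < R y s" using U(2) mult_pos_pos[OF d0(1) exp_gt_zero, of "- A * s"] by (simp add: U2_def)
      have l1: "0 < l1 y s" "l1 y s \<le> l2 y s" "l2 y s - l1 y s = (\<gamma> - 1) / 2 * (R y s - S y s)"
        using lam_order[OF \<gamma> S0 less_imp_le[OF SR]] by (auto simp: l1_def l2_def)
      have g0: "0 \<le> g y s" using source_nonneg[OF \<gamma>(1) k_nonneg[OF y] S0] SR by (simp add: g_def)
      have bnd: "R y s \<le> B" "k y \<le> B" "\<bar>Sx y s\<bar> \<le> B" "\<bar>Rx y s\<bar> \<le> B"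
        using B(2)[OF y, of s] s by auto
      have p_le: "St y s \<le> h" and q_le: "Rt y s \<le> h"
        using U(3,4) by (auto simp: U3_def U4_def h_def)
      have e1: "0 < E1 y s" using g0 s0(1) T by (simp add: E1_def add_nonneg_pos)
      have e2: "0 < E2 y s" if "U2 y s = 0"
      proof -
        define \<sigma> where "\<sigma> = R y s - S y s"
        have \<sigma>: "0 < \<sigma>" "d0 * exp (- A * s) = \<sigma>" using SR that by (auto simp: \<sigma>_def U2_def)
        have "E2 y s = A * (d0 * exp (- A * s)) - 2 * g y s - (l2 y s - l1 y s) * Sx y s"
          by (simp add: E2_def)
        also have "\<dots> = \<sigma> * (A - (\<gamma> - 1) / 4 * (k y * (R y s + S y s)) - (\<gamma> - 1) / 2 * Sx y s)"
          unfolding \<sigma>(2) l1(3)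
          by (simp add: \<sigma>_def g_def source_def power2_eq_square algebra_simps add_divide_distrib diff_divide_distrib)
        also have "\<dots> > 0"
        proof (rule mult_pos_pos[OF \<sigma>(1)])
          have "(\<gamma> - 1) / 4 * (k y * (R y s + S y s)) \<le> 1 / 2 * (B * (B + B))"
            using \<gamma> k_nonneg[OF y] S0 SR bnd B(1) by (intro mult_mono add_mono) auto
          moreover have "(\<gamma> - 1) / 2 * Sx y s \<le> 1 * B"
            by (rule abs_le_D1, unfold abs_mult) (use \<gamma> bnd in \<open>intro mult_mono; auto\<close>)
          ultimately show "0 < A - (\<gamma> - 1) / 4 * (k y * (R y s + S y s)) - (\<gamma> - 1) / 2 * Sx y s"
            unfolding A_def power2_eq_square by (simp only: distrib_left)
        qed
        finally show ?thesis .
      qed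
      have Lh: "L * \<eta> * exp (L * s) = (B\<^sup>2 + 2 * B) * h + h"
        by (simp add: L_def h_def algebra_simps)
      have e3: "0 < E3 y s" if "U3 y s = 0"
      proof -
        have "St y s = h" using that by (simp add: U3_def h_def)
        from barrier_S_t[OF \<gamma> S0 SR k_nonneg[OF y] eqS[OF y] this q_le h0 bnd(1,2,3)] s
        have "0 \<le> - (gt y s - l1t y s * Sx y s) + (B\<^sup>2 + 2 * B) * h"
          by (simp add: gt_def l1t_def)
        then show ?thesis unfolding E3_def Lh using h0 by linarith
      qed
      have e4: "0 < E4 y s" if "U4 y s = 0"
      proof -
        have "Rt y s = h" using that by (simp add: U4_def h_def)
        from barrier_R_t[OF \<gamma> S0 SR k_nonneg[OF y] eqR[OF y] p_le this h0 bnd(1,2,4)] s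
        have "0 \<le> gt y s + l2t y s * Rx y s + (B\<^sup>2 + 2 * B) * h"
          by (simp add: gt_def l2t_def)
        then show ?thesis unfolding E4_def Lh using h0 by linarith
      qed
      show "0 < l y s \<and> 0 < E y s"
        using u zero e1 e2 e3 e4 l1 by (auto simp: F_def)
    qed
    show ?thesis
      using pos[of U1 l1 E1 x t] pos[of U2 l2 E2 x t] pos[of U3 l1 E3 x t] pos[of U4 l2 E4 x t] xt
      by (simp add: F_def U1_def U2_def U3_def U4_def)
  qed

  have "0 < s0 * (1 - t / (2 * T))" using s0(1) xt T by (simp add: field_simps)
  moreover have "0 < d0 * exp (- A * t)" using d0(1) by simp
  moreover have "S x t > s0 * (1 - t / (2 * T))" "R x t - S x t > d0 * exp (- A * t)"
    using perturbed[of 1] by simp_all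
  ultimately have "0 < S x t" "S x t < R x t" by linarith+
  moreover have limit: "y \<le> 0" if y: "\<And>\<eta>. 0 < \<eta> \<Longrightarrow> y < \<eta> * exp (L * t)" for y :: real
  proof (rule field_le_epsilon)
    fix e :: real assume "0 < e"
    with y[of "e / exp (L * t)"] show "y \<le> 0 + e" by simp
  qed
  moreover have "St x t \<le> 0" "Rt x t \<le> 0" using perturbed by (auto intro!: limit)
  ultimately show ?thesis by blast
qed

section \<open>Consequences of the slope bound for the initial data\<close>

text \<open>
  For small \<open>\<xi>\<close> the required slope is close to \<open>k S / (- 2 b)\<close>, so it is at least three quarters of
  this value. If \<open>b = -1\<close>, the correction is \<open>- \<epsilon> \<xi>\<close> with \<open>\<epsilon> = ln (R - S)\<close>. This logarithm need not be small
  compared with \<open>1 / \<xi>\<close>, but it has the right sign as soon as \<open>R - S \<le> 1\<close>.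
\<close>

lemma initial_slope_lower_bound:
  assumes sl: "initial_slope_bounds b I k S R" and x: "x \<in> I" and b: "b < 0"
    and sr: "0 < S x" "S x < R x" and k: "0 \<le> k x"
    and near: "b \<noteq> -1 \<Longrightarrow> xi (S x) (R x) \<le> \<bar>b + 1\<bar> / (- 4 * b)" and low: "R x - S x \<le> 1"
  shows "3 * (k x * S x) / (- 8 * b) \<le> deriv_on I S x"
proof -
  define e where "e = eps (S x) (R x)"
  define \<xi> where "\<xi> = xi (S x) (R x)"
  have \<xi>: "0 < \<xi>" using sr by (simp add: \<xi>_def xi_def)
  have ks: "0 \<le> k x * S x / 2" using k sr by simp
  show ?thesis
  proof (cases "b = -1")
    case True
    have "S x * \<xi> = R x - S x" using sr by (simp add: \<xi>_def xi_def field_simps)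
    then have "e \<le> 0" using low sr by (simp add: e_def eps_def \<xi>_def[symmetric])
    then have "e * \<xi> \<le> 0" using \<xi> by (simp add: mult_nonpos_nonneg)
    then have "k x * S x / 2 * (3 / 4) \<le> k x * S x / 2 * (1 - e * \<xi>)" using ks by (intro mult_left_mono) auto
    also have "\<dots> \<le> deriv_on I S x"
      using sl x True unfolding initial_slope_bounds_def Let_def e_def \<xi>_def by blast
    finally show ?thesis using True by simp
  next
    case False
    have "1 / (b + 1) * \<xi> \<le> \<xi> / \<bar>b + 1\<bar>"
      using abs_ge_self[of "\<xi> / (b + 1)"] \<xi> by (simp add: abs_divide)
    also have "\<dots> \<le> 1 / (- 4 * b)" using near[OF False] False b by (simp add: \<xi>_def field_simps)
    finally have "3 / (- 4 * b) \<le> 1 / (- b) - 1 / (b + 1) * \<xi>" using b by (simp add: field_simps)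
    then have "k x * S x / 2 * (3 / (- 4 * b)) \<le> k x * S x / 2 * (1 / (- b) - 1 / (b + 1) * \<xi>)"
      using ks by (intro mult_left_mono) auto
    also have "\<dots> \<le> deriv_on I S x"
      using sl x False unfolding initial_slope_bounds_def Let_def \<xi>_def by blast
    finally show ?thesis by simp
  qed
qed

text \<open>
  The conclusion says that \<open>S\<^sub>t \<le> 0\<close> at time 0: the source is of second order in \<open>S\<close> with the small
  factor \<open>\<xi>\<close>, whereas \<open>\<lambda>\<^sub>1 S' \<ge> 3 k S\<^sup>2 / (- 8 b)\<close>.
\<close>

lemma initial_source_le_transport:
  assumes \<gamma>: "1 < \<gamma>" "\<gamma> < 3" and sl: "initial_slope_bounds b I k S R" and x: "x \<in> I" and b: "b < 0"
    and sr: "0 < S x" "S x < R x" and k: "0 \<le> k x" and low: "R x - S x \<le> 1"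
    and near: "b \<noteq> -1 \<Longrightarrow> xi (S x) (R x) \<le> \<bar>b + 1\<bar> / (- 4 * b)"
      "xi (S x) (R x) \<le> 1" "xi (S x) (R x) \<le> 3 / (- 8 * b)"
  shows "source \<gamma> (k x) (S x) (R x) \<le> lam1 \<gamma> (S x) (R x) * deriv_on I S x"
proof -
  let ?\<xi> = "xi (S x) (R x)"
  have slope: "3 * (k x * S x) / (- 8 * b) \<le> deriv_on I S x"
    using near(1) low by (intro initial_slope_lower_bound[where S = S and R = R and k = k, OF sl x b sr k]) auto
  have "R x = (1 + ?\<xi>) * S x" "0 \<le> ?\<xi>" using sr by (auto simp: xi_def)
  then have "source \<gamma> (k x) (S x) (R x) \<le> ?\<xi> * (k x * (S x)\<^sup>2)"
    using sr near(2) by (intro source_le_of_close \<gamma> k) auto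
  also have "\<dots> \<le> 3 / (- 8 * b) * (k x * (S x)\<^sup>2)"
    using near(3) k by (intro mult_right_mono) auto
  also have "\<dots> = S x * (3 * (k x * S x) / (- 8 * b))" by (simp add: power2_eq_square)
  also have "\<dots> \<le> lam1 \<gamma> (S x) (R x) * deriv_on I S x"
  proof (intro mult_mono slope)
    have "(3 - \<gamma>) * S x \<le> (3 - \<gamma>) * R x" using \<gamma> sr by (intro mult_left_mono) auto
    then show "S x \<le> lam1 \<gamma> (S x) (R x)" unfolding lam1_def by (simp add: field_simps)
    show "0 \<le> lam1 \<gamma> (S x) (R x)" using lam_order(1)[OF \<gamma> sr(1), of "R x"] sr by simp
    show "0 \<le> 3 * (k x * S x) / (- 8 * b)" using b k sr by (intro divide_nonneg_pos) auto
  qed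
  finally show ?thesis .
qed

section \<open>The solution on its whole domain\<close>

lemma deriv_on_eqI:
  assumes f: "(f has_real_derivative d) (at x within A)" and eq: "\<And>y. y \<in> A \<Longrightarrow> f y = h y"
    and A: "x \<in> A" "at x within A \<noteq> bot"
  shows "deriv_on A h x = d"
proof -
  have "(h has_real_derivative d) (at x within A)"
    using f unfolding has_field_derivative_def
    by (rule has_derivative_transform[OF A(1), rotated]) (simp add: eq)
  then show ?thesis
    unfolding deriv_on_def has_real_derivative_iff_has_vector_derivative
    by (rule vector_derivative_within[OF A(2)])
qed

lemma C1_on_has_derivative:
  assumes "C1_on A f" "x \<in> A"
  shows "(f has_real_derivative deriv_on A f x) (at x within A)"
  unfolding deriv_on_def has_real_derivative_iff_has_vector_derivative
  by (rule vector_derivative_works[THEN iffD1]) (use assms in \<open>simp add: C1_on_def\<close>)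

lemma vanishing_extends_to_boundary:
  fixes I :: "real set" and w :: "real \<Rightarrow> real \<Rightarrow> real"
  assumes I: "xB < xC \<and> I = {xB..xC} \<or> I = {xB..}"
    and w: "continuous_on (I \<times> {0..}) (\<lambda>p. w (fst p) (snd p))"
    and eq: "\<And>x t. x \<in> interior I \<Longrightarrow> 0 < t \<Longrightarrow> w x t = 0"
    and xt: "x \<in> I" "0 \<le> t"
  shows "w x t = 0"
proof -
  have "closure (interior I) = I"
    using I by (auto simp: interior_real_atLeast)
  then have cl: "closure (interior I \<times> {0::real<..}) = I \<times> {0..}"
    by (simp add: closure_Times)
  have "(\<lambda>p. w (fst p) (snd p)) (x, t) = 0"
    by (rule continuous_constant_on_closure[of "interior I \<times> {0<..}"]) (use w eq xt in \<open>auto simp: cl\<close>)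
  then show ?thesis by simp
qed

lemma at_within_interval_not_bot:
  fixes I :: "real set"
  assumes "xB < xC \<and> I = {xB..xC} \<or> I = {xB..}" "x \<in> I"
  shows "at x within I \<noteq> bot"
proof -
  have "connected I" using assms(1) by auto
  moreover have "I \<noteq> {y}" for y
  proof -
    obtain u v where "u \<in> I" "v \<in> I" "u < v"
      using assms(1) by (metis atLeast_iff atLeastAtMost_iff less_eq_real_def gt_ex order_refl)
    then show ?thesis by auto
  qed
  ultimately show ?thesis
    using connected_imp_perfect assms(2) by (auto simp: trivial_limit_within)
qed

text \<open>
  A point \<open>(x, t)\<close> lies in the rectangle \<open>[x\<^sub>B, x] \<times> [0, t + 1]\<close>. The equations extend by continuity from
  the interior of the domain to its boundary, where they turn the slopes of the data into the signs of
  \<open>S\<^sub>t\<close> and \<open>R\<^sub>t\<close> at time 0.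
\<close>

lemma solution_invariants:
  assumes \<gamma>: "1 < \<gamma>" "\<gamma> < 3"
    and I: "xB < xC \<and> I = {xB..xC} \<or> I = {xB..}"
    and k: "bounded_C1_coeff I k"
    and init: "\<And>x. x \<in> I \<Longrightarrow> 0 < S0 x \<and> S0 x < R0 x \<and> 0 \<le> deriv_on I R0 x \<and>
       source \<gamma> (k x) (S0 x) (R0 x) \<le> lam1 \<gamma> (S0 x) (R0 x) * deriv_on I S0 x"
    and bdry: "\<And>t. 0 \<le> t \<Longrightarrow> 0 < SB t \<and> SB t < RB t \<and>
       deriv_on {0..} SB t \<le> 0 \<and> deriv_on {0..} RB t \<le> 0"
    and sol: "global_C1_solution \<gamma> I xB k S0 R0 SB RB S R"
  obtains Sx St Rx Rt where
    "partials_on (I \<times> {0..}) S Sx St" "partials_on (I \<times> {0..}) R Rx Rt"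
    "\<And>x t. x \<in> I \<Longrightarrow> 0 \<le> t \<Longrightarrow> 0 < S x t \<and> S x t < R x t \<and> St x t \<le> 0 \<and> Rt x t \<le> 0 \<and>
       St x t + lam1 \<gamma> (S x t) (R x t) * Sx x t = source \<gamma> (k x) (S x t) (R x t) \<and>
       Rt x t + lam2 \<gamma> (S x t) (R x t) * Rx x t = - source \<gamma> (k x) (S x t) (R x t)"
proof -
  let ?D = "I \<times> {0..}"
  obtain Sx St Rx Rt where S: "has_C1_partials ?D S Sx St" and R: "has_C1_partials ?D R Rx Rt"
    and eq: "\<And>x t. x \<in> interior I \<Longrightarrow> 0 < t \<Longrightarrow>
      St x t + lam1 \<gamma> (S x t) (R x t) * Sx x t = source \<gamma> (k x) (S x t) (R x t) \<and>
      Rt x t + lam2 \<gamma> (S x t) (R x t) * Rx x t = - source \<gamma> (k x) (S x t) (R x t)"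
    and ic: "\<And>x. x \<in> I \<Longrightarrow> S x 0 = S0 x \<and> R x 0 = R0 x"
    and bc: "\<And>t. 0 \<le> t \<Longrightarrow> S xB t = SB t \<and> R xB t = RB t"
    using sol unfolding global_C1_solution_def by metis
  have pdS: "partials_on ?D S Sx St" and pdR: "partials_on ?D R Rx Rt"
    using S R by (auto dest: has_C1_partials_imp_partials_on)
  have xB: "xB \<in> I" "\<And>x. x \<in> I \<Longrightarrow> {xB..x} \<subseteq> I" using I by auto
  have k0: "\<And>x. x \<in> I \<Longrightarrow> 0 \<le> k x" and kd: "\<And>x. x \<in> I \<Longrightarrow> (k has_real_derivative deriv_on I k x) (at x within I)"
    using k C1_on_has_derivative by (auto simp: bounded_C1_coeff_def)
  have "continuous_on I k" using kd by (meson DERIV_continuous continuous_on_eq_continuous_within)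
  then have k_cont: "continuous_on ?D (\<lambda>p. k (fst p))"
    by (rule continuous_on_compose2) (auto intro: continuous_intros)
  have cont: "continuous_on ?D (\<lambda>p. S (fst p) (snd p))" "continuous_on ?D (\<lambda>p. R (fst p) (snd p))"
    "continuous_on ?D (\<lambda>p. Sx (fst p) (snd p))" "continuous_on ?D (\<lambda>p. St (fst p) (snd p))"
    "continuous_on ?D (\<lambda>p. Rx (fst p) (snd p))" "continuous_on ?D (\<lambda>p. Rt (fst p) (snd p))"
    using partials_on_continuous[OF pdS] partials_on_continuous[OF pdR] S R
    by (auto simp: has_C1_partials_def case_prod_unfold)
  have eqS: "St x t + lam1 \<gamma> (S x t) (R x t) * Sx x t - source \<gamma> (k x) (S x t) (R x t) = 0"
    if "x \<in> I" "0 \<le> t" for x t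
    by (rule vanishing_extends_to_boundary[OF I _ _ that])
       (use eq in \<open>auto simp: lam1_def source_def intro!: continuous_intros cont k_cont\<close>)
  have eqR: "Rt x t + lam2 \<gamma> (S x t) (R x t) * Rx x t + source \<gamma> (k x) (S x t) (R x t) = 0"
    if "x \<in> I" "0 \<le> t" for x t
    by (rule vanishing_extends_to_boundary[OF I _ _ that])
       (use eq in \<open>auto simp: lam2_def source_def intro!: continuous_intros cont k_cont\<close>)
  have at0: "at t within {0..} \<noteq> bot" if "0 \<le> t" for t :: real
    using at_within_interval_not_bot[of 0 1 "{0..}" t] that by simp
  have dS0: "deriv_on I S0 x = Sx x 0" and dR0: "deriv_on I R0 x = Rx x 0" if "x \<in> I" for x
    using ic that at_within_interval_not_bot[OF I that]
    by (auto intro!: deriv_on_eqI partials_on_slice_space[OF pdS] partials_on_slice_space[OF pdR])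
  have dSB: "deriv_on {0..} SB t = St xB t" and dRB: "deriv_on {0..} RB t = Rt xB t" if "0 \<le> t" for t
    using bc that at0[OF that] xB
    by (auto intro!: deriv_on_eqI partials_on_slice_time[OF pdS] partials_on_slice_time[OF pdR])
  have data: "0 < S x t \<and> S x t < R x t \<and> St x t \<le> 0 \<and> Rt x t \<le> 0"
    if x: "x \<in> I" and t: "0 \<le> t" and xt: "x = xB \<or> t = 0" for x t
  proof (cases "t = 0")
    case True
    have i: "0 < S x 0" "S x 0 < R x 0" "0 \<le> Rx x 0"
       "source \<gamma> (k x) (S x 0) (R x 0) \<le> lam1 \<gamma> (S x 0) (R x 0) * Sx x 0"
      using init[OF x] ic[OF x] dS0[OF x] dR0[OF x] by auto
    note lam = lam_order[OF \<gamma> i(1) less_imp_le[OF i(2)]]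
    have "0 \<le> source \<gamma> (k x) (S x 0) (R x 0)" using source_nonneg \<gamma> k0[OF x] i by simp
    moreover have "0 \<le> lam2 \<gamma> (S x 0) (R x 0) * Rx x 0" using lam i by simp
    ultimately have "St x 0 \<le> 0" "Rt x 0 \<le> 0" using eqS[OF x, of 0] eqR[OF x, of 0] i(4) by auto
    then show ?thesis using True i by simp
  next
    case False
    with xt have "x = xB" by simp
    then show ?thesis using bdry[OF t] bc[OF t] dSB[OF t] dRB[OF t] by simp
  qed
  have inv: "0 < S x t \<and> S x t < R x t \<and> St x t \<le> 0 \<and> Rt x t \<le> 0"
    if x: "x \<in> I" and t: "0 \<le> t" for x t
  proof -
    note sub = xB(2)[OF x]
    have D: "{xB..x} \<times> {0..} \<subseteq> ?D" using sub by auto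
    have restrict: "has_C1_partials ({xB..x} \<times> {0..}) u ux ut" if "has_C1_partials ?D u ux ut" for u ux ut
      using that D unfolding has_C1_partials_def
      by (auto intro: has_derivative_subset continuous_on_subset)
    have "xB \<le> x" using x I by auto
    show ?thesis
    proof (rule rectangle_invariants[OF \<gamma>, where T = "t + 1" and a = xB and b = x and
          k = k and k' = "deriv_on I k" and S = S and R = R and Sx = Sx and Rx = Rx and
          St = St and Rt = Rt and x = x and t = t])
      show "(k has_real_derivative deriv_on I k y) (at y within {xB..x})" if "y \<in> {xB..x}" for y
        by (rule has_field_derivative_subset[OF kd sub]) (use that sub in blast)
      show "St y s + lam1 \<gamma> (S y s) (R y s) * Sx y s = source \<gamma> (k y) (S y s) (R y s)"
        if "y \<in> {xB..x}" "0 \<le> s" for y s using eqS[of y s] that sub by force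
      show "Rt y s + lam2 \<gamma> (S y s) (R y s) * Rx y s = - source \<gamma> (k y) (S y s) (R y s)"
        if "y \<in> {xB..x}" "0 \<le> s" for y s using eqR[of y s] that sub by force
      show "0 < S y s \<and> S y s < R y s \<and> St y s \<le> 0 \<and> Rt y s \<le> 0"
        if "y \<in> {xB..x}" "0 \<le> s" "y = xB \<or> s = 0" for y s using data[of y s] that sub by force
      show "0 \<le> k y" if "y \<in> {xB..x}" for y using k0 that sub by force
    qed (use t restrict[OF S] restrict[OF R] \<open>xB \<le> x\<close> in auto)
  qed
  show thesis
  proof (rule that[OF pdS pdR])
    fix x t assume x: "x \<in> I" and t: "(0::real) \<le> t"
    show "0 < S x t \<and> S x t < R x t \<and> St x t \<le> 0 \<and> Rt x t \<le> 0 \<and>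
       St x t + lam1 \<gamma> (S x t) (R x t) * Sx x t = source \<gamma> (k x) (S x t) (R x t) \<and>
       Rt x t + lam2 \<gamma> (S x t) (R x t) * Rx x t = - source \<gamma> (k x) (S x t) (R x t)"
      using inv[OF x t] eqS[OF x t] eqR[OF x t] by auto
  qed
qed

section \<open>Behaviour along characteristic curves\<close>

lemma mono_on_of_derivative_within:
  fixes f :: "real \<Rightarrow> real"
  assumes J: "is_interval J"
    and f: "\<And>t. t \<in> J \<Longrightarrow> (f has_real_derivative f' t) (at t within J)" and nonneg: "\<And>t. t \<in> J \<Longrightarrow> 0 \<le> f' t"
  shows "mono_on J f"
proof (rule mono_onI)
  fix s t assume st: "s \<in> J" "t \<in> J" "s \<le> t"
  have sub: "{s..t} \<subseteq> J"
    using mem_is_interval_1_I[OF J st(1,2)] by auto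
  then have "(f has_derivative (\<lambda>h. f' u * h)) (at u within {s..t})" if "s \<le> u" "u \<le> t" for u
  proof -
    have "u \<in> J" using that sub by auto
    from has_field_derivative_subset[OF f[OF this] sub] show ?thesis
      by (simp add: has_field_derivative_def)
  qed
  from mvt_very_simple[OF st(3) this] obtain u where "u \<in> {s..t}" "f t - f s = f' u * (t - s)" by blast
  then have "u \<in> J" and eq: "f t - f s = f' u * (t - s)" using sub by auto
  have "0 \<le> f' u * (t - s)" using nonneg[OF \<open>u \<in> J\<close>] st(3) by simp
  then show "f s \<le> f t" using eq by simp
qed

lemma char_curve_monotone:
  assumes \<gamma>: "1 < \<gamma>" "\<gamma> < 3" and k0: "\<And>x. x \<in> I \<Longrightarrow> 0 \<le> k x"
    and S: "partials_on (I \<times> {0..}) S Sx St" and R: "partials_on (I \<times> {0..}) R Rx Rt"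
    and sol: "\<And>x t. x \<in> I \<Longrightarrow> 0 \<le> t \<Longrightarrow> 0 < S x t \<and> S x t < R x t \<and> St x t \<le> 0 \<and> Rt x t \<le> 0 \<and>
       St x t + lam1 \<gamma> (S x t) (R x t) * Sx x t = source \<gamma> (k x) (S x t) (R x t) \<and>
       Rt x t + lam2 \<gamma> (S x t) (R x t) * Rx x t = - source \<gamma> (k x) (S x t) (R x t)"
    and lam: "lam \<in> {lam1 \<gamma>, lam2 \<gamma>}"
    and J: "is_interval J" "\<And>t. t \<in> J \<Longrightarrow> 0 \<le> t"
    and x: "\<And>t. t \<in> J \<Longrightarrow> x t \<in> I \<and>
       (x has_real_derivative lam (S (x t) t) (R (x t) t)) (at t within J)"
  shows "mono_on J (\<lambda>t. S (x t) t)" "antimono_on J (\<lambda>t. R (x t) t)"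
    "antimono_on J (\<lambda>t. xi (S (x t) t) (R (x t) t))"
proof -
  have D: "\<And>t. t \<in> J \<Longrightarrow> (x t, t) \<in> I \<times> {0..}" using J(2) x by auto
  have signs: "0 \<le> Sx (x t) t * lam (S (x t) t) (R (x t) t) + St (x t) t \<and>
      0 \<le> - (Rx (x t) t * lam (S (x t) t) (R (x t) t) + Rt (x t) t)" if t: "t \<in> J" for t
  proof -
    define s r p q w z l1 l2 g where defs: "s = S (x t) t" "r = R (x t) t" "p = St (x t) t" "q = Rt (x t) t"
      "w = Sx (x t) t" "z = Rx (x t) t" "l1 = lam1 \<gamma> s r" "l2 = lam2 \<gamma> s r" "g = source \<gamma> (k (x t)) s r"
    have h: "0 < s" "s < r" "p \<le> 0" "q \<le> 0" "p + l1 * w = g" "q + l2 * z = - g"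
      using sol[of "x t" t] x[OF t] J(2)[OF t] unfolding defs by blast+
    have l: "0 < l1" "l1 \<le> l2" using lam_order[OF \<gamma> h(1)] h(2) by (auto simp: defs)
    have g: "0 \<le> g" using source_nonneg[OF \<gamma>(1) k0 h(1)] x[OF t] h(2) by (auto simp: defs)
    have "0 \<le> p + l2 * w" by (rule derivative_along_faster_curve[OF l h(5) g h(3)])
    moreover have "q + l1 * z \<le> 0" by (rule derivative_along_slower_curve[OF l h(6) g h(4) order_refl])
    ultimately have "0 \<le> w * l + p \<and> 0 \<le> - (z * l + q)" if "l \<in> {l1, l2}" for l
      using that g h(5,6) by (auto simp: algebra_simps)
    then show ?thesis using lam unfolding defs by auto
  qed
  have "((\<lambda>t. S (x t) t) has_real_derivative Sx (x t) t * lam (S (x t) t) (R (x t) t) + St (x t) t) (at t within J)"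
    if "t \<in> J" for t using x[OF that] by (intro partials_on_along_curve[OF S _ that D]) auto
  then show mono: "mono_on J (\<lambda>t. S (x t) t)"
    using signs by (intro mono_on_of_derivative_within[OF J(1)]) auto
  have "((\<lambda>t. R (x t) t) has_real_derivative Rx (x t) t * lam (S (x t) t) (R (x t) t) + Rt (x t) t) (at t within J)"
    if "t \<in> J" for t using x[OF that] by (intro partials_on_along_curve[OF R _ that D]) auto
  then have "((\<lambda>t. - R (x t) t) has_real_derivative - (Rx (x t) t * lam (S (x t) t) (R (x t) t) + Rt (x t) t)) (at t within J)"
    if "t \<in> J" for t using that by (intro DERIV_minus)
  then have "mono_on J (\<lambda>t. - R (x t) t)"
    using signs by (intro mono_on_of_derivative_within[OF J(1)]) auto
  then show anti: "antimono_on J (\<lambda>t. R (x t) t)"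
    by (auto simp: monotone_on_def)
  show "antimono_on J (\<lambda>t. xi (S (x t) t) (R (x t) t))"
  proof (rule monotone_onI)
    fix s t assume st: "s \<in> J" "t \<in> J" "s \<le> t"
    have "R (x t) t / S (x t) t \<le> R (x s) s / S (x s) s"
      using monotone_onD[OF mono st] monotone_onD[OF anti st] sol[of "x s" s] sol[of "x t" t] x st J(2)
      by (intro frac_le) (auto intro: less_imp_le order_trans)
    then show "xi (S (x t) t) (R (x t) t) \<le> xi (S (x s) s) (R (x s) s)" by (simp add: xi_def)
  qed
qed

text \<open>
  Both quantities are controlled by \<open>R - S\<close>: the density is a constant times a positive power of it,
  and \<open>\<xi> = (R - S) / S\<close> has a denominator that stays between two positive constants.
\<close>

lemma xi_tendsto_0_iff_density:
  fixes s r :: "'a \<Rightarrow> real"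
  assumes \<gamma>: "1 < \<gamma>" and \<nu>: "0 < \<nu>" and c: "0 < c"
    and ev: "\<forall>\<^sub>F t in F. c \<le> s t \<and> s t \<le> r t \<and> r t \<le> M"
  shows "((\<lambda>t. xi (s t) (r t)) \<longlongrightarrow> 0) F \<longleftrightarrow> ((\<lambda>t. gas_density \<gamma> \<nu> (s t) (r t)) \<longlongrightarrow> 0) F"
proof -
  define a where "a = 2 / (\<gamma> - 1)"
  define K where "K = ((\<gamma> - 1) / (16 * \<nu>)) powr (1 / (\<gamma> - 1))"
  have a: "0 < a" using \<gamma> by (simp add: a_def)
  have K: "0 < K" using \<gamma> \<nu> by (simp add: K_def)
  have nonneg: "\<forall>\<^sub>F t in F. 0 \<le> r t - s t" using ev by eventually_elim auto
  have "((\<lambda>t. xi (s t) (r t)) \<longlongrightarrow> 0) F \<longleftrightarrow> ((\<lambda>t. r t - s t) \<longlongrightarrow> 0) F"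
  proof
    assume lim: "((\<lambda>t. xi (s t) (r t)) \<longlongrightarrow> 0) F"
    show "((\<lambda>t. r t - s t) \<longlongrightarrow> 0) F"
    proof (rule Lim_null_comparison)
      show "((\<lambda>t. M * xi (s t) (r t)) \<longlongrightarrow> 0) F" using tendsto_mult_left[OF lim, of M] by simp
      show "\<forall>\<^sub>F t in F. norm (r t - s t) \<le> M * xi (s t) (r t)"
        using ev
      proof eventually_elim
        case (elim t)
        then have "r t - s t = s t * xi (s t) (r t)" "0 \<le> xi (s t) (r t)" using c by (auto simp: xi_def field_simps)
        with elim show ?case using c by (simp add: mult_right_mono)
      qed
    qed
  next
    assume lim: "((\<lambda>t. r t - s t) \<longlongrightarrow> 0) F"
    show "((\<lambda>t. xi (s t) (r t)) \<longlongrightarrow> 0) F"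
    proof (rule Lim_null_comparison)
      show "((\<lambda>t. (r t - s t) / c) \<longlongrightarrow> 0) F" using tendsto_divide[OF lim tendsto_const, of c] c by simp
      show "\<forall>\<^sub>F t in F. norm (xi (s t) (r t)) \<le> (r t - s t) / c"
        using ev
      proof eventually_elim
        case (elim t)
        then have "xi (s t) (r t) = (r t - s t) / s t" using c by (simp add: xi_def field_simps)
        with elim show ?case using c by (simp add: frac_le)
      qed
    qed
  qed
  also have "\<dots> \<longleftrightarrow> ((\<lambda>t. (r t - s t) powr a) \<longlongrightarrow> 0) F"
  proof
    assume lim: "((\<lambda>t. r t - s t) \<longlongrightarrow> 0) F"
    show "((\<lambda>t. (r t - s t) powr a) \<longlongrightarrow> 0) F"
      by (rule tendsto_zero_powrI[OF lim tendsto_const nonneg a])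
  next
    assume lim: "((\<lambda>t. (r t - s t) powr a) \<longlongrightarrow> 0) F"
    have "((\<lambda>t. ((r t - s t) powr a) powr (1 / a)) \<longlongrightarrow> 0) F"
      by (rule tendsto_zero_powrI[OF lim tendsto_const]) (use a in auto)
    moreover have "\<forall>\<^sub>F t in F. ((r t - s t) powr a) powr (1 / a) = r t - s t"
      using nonneg by eventually_elim (use a in \<open>simp add: powr_powr\<close>)
    ultimately show "((\<lambda>t. r t - s t) \<longlongrightarrow> 0) F" by (rule Lim_transform_eventually)
  qed
  also have "\<dots> \<longleftrightarrow> ((\<lambda>t. K * (r t - s t) powr a) \<longlongrightarrow> 0) F"
    using tendsto_mult_left_iff[of K "\<lambda>t. (r t - s t) powr a" 0 F] K by simp
  finally show ?thesis by (simp add: gas_density_def K_def a_def)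
qed

lemma eventually_right_end:
  assumes J: "is_interval J" "t0 \<in> J"
  shows "\<forall>\<^sub>F t in right_end J. t \<in> J"
proof (cases "bdd_above J")
  case True
  then show ?thesis by (simp add: right_end_def eventually_inf_principal)
next
  case False
  have "t \<in> J" if "t0 \<le> t" for t
  proof -
    have "\<not> (\<forall>u\<in>J. u \<le> t)" using False unfolding bdd_above_def by blast
    then obtain u where u: "u \<in> J" "t \<le> u" by force
    show ?thesis by (rule mem_is_interval_1_I[OF J(1,2) u(1) that u(2)])
  qed
  then have "\<forall>\<^sub>F t in at_top. t \<in> J" unfolding eventually_at_top_linorder by blast
  then show ?thesis using False by (simp add: right_end_def)
qed

theorem proposition3p9:
  fixes \<gamma> b \<delta> xB xC :: real
    and I :: "real set"
    and k :: "real \<Rightarrow> real"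
    and S0 R0 SB RB :: "real \<Rightarrow> real \<Rightarrow> real"
  assumes gamma: "1 < \<gamma>" "\<gamma> < 3"
    and b: "b = - ((3 - \<gamma>) / (2 * (\<gamma> - 1)))"
    and I: "xB < xC \<and> I = {xB..xC} \<or> I = {xB..}"
    and A1: "bounded_C1_coeff I k"
    and delta: "0 < \<delta>" "\<delta> < 2"
    and k_deriv: "\<forall>x\<in>I. deriv_on I k x \<le> (k x)\<^sup>2 / ((2 - \<delta>) * b)"
    and A2: "compatible_data \<gamma> I xB k S0 R0 SB RB"
    and A3: "admissible_data I S0 R0"
    and A4: "admissible_data {0..} SB RB"
    and A5: "monotone_small_data I S0 R0 SB RB"
    and initial: "\<forall>\<^sub>F \<nu> in at_right 0. initial_slope_bounds b I k (S0 \<nu>) (R0 \<nu>)"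
    and boundary: "\<forall>\<^sub>F \<nu> in at_right 0. boundary_slope_bounds b xB k (SB \<nu>) (RB \<nu>)"
  shows "\<exists>\<nu>s>0. \<forall>\<nu>. 0 < \<nu> \<and> \<nu> \<le> \<nu>s \<longrightarrow>
    (\<forall>S R. global_C1_solution \<gamma> I xB k (S0 \<nu>) (R0 \<nu>) (SB \<nu>) (RB \<nu>) S R \<longrightarrow>
      (\<forall>lam\<in>{lam1 \<gamma>, lam2 \<gamma>}. \<forall>J x.
        (char_curve I xB lam S R J x \<longrightarrow>
           mono_on J (\<lambda>t. S (x t) t) \<and>
           antimono_on J (\<lambda>t. R (x t) t) \<and>
           antimono_on J (\<lambda>t. xi (S (x t) t) (R (x t) t))) \<and>
        (maximal_char_curve I xB lam S R J x \<longrightarrow>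
           (((\<lambda>t. xi (S (x t) t) (R (x t) t)) \<longlongrightarrow> 0) (right_end J) \<longleftrightarrow>
            ((\<lambda>t. gas_density \<gamma> \<nu> (S (x t) t) (R (x t) t)) \<longlongrightarrow> 0) (right_end J)))))"
proof -
  have b_neg: "b < 0" using gamma by (simp add: b)
  have k0: "\<And>x. x \<in> I \<Longrightarrow> 0 \<le> k x" using A1 by (simp add: bounded_C1_coeff_def)
  \<comment> \<open>For \<open>\<xi>\<^sub>0 \<le> X\<close> the slope bound forces \<open>S\<^sub>t \<le> 0\<close> at time 0; for \<open>b = -1\<close> the further
    requirement \<open>R\<^sub>0 - S\<^sub>0 \<le> 1\<close> follows from \<open>R\<^sub>0 - S\<^sub>0 = S\<^sub>0 \<xi>\<^sub>0\<close> and the bound \<open>C0\<close> of \<open>S\<^sub>0\<close>.\<close>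
  define X where "X = min (min 1 (3 / (- 8 * b))) (if b = -1 then 1 else \<bar>b + 1\<bar> / (- 4 * b))"
  have "b \<noteq> -1 \<Longrightarrow> 0 < \<bar>b + 1\<bar> / (- 4 * b)"
    using b_neg by (intro divide_pos_pos) auto
  then have X: "0 < X" "X \<le> 1" "X \<le> 3 / (- 8 * b)" "b \<noteq> -1 \<Longrightarrow> X \<le> \<bar>b + 1\<bar> / (- 4 * b)"
    using b_neg by (auto simp: X_def)
  obtain C0 where C0: "\<forall>\<^sub>F \<nu> in at_right 0. C1_on I (S0 \<nu>) \<and> C1_on I (R0 \<nu>) \<and>
      C1_norm_le I (S0 \<nu>) C0 \<and> C1_norm_le I (R0 \<nu>) C0 \<and> (\<forall>x\<in>I. 0 < S0 \<nu> x \<and> S0 \<nu> x < R0 \<nu> x)"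
    using A3 unfolding admissible_data_def by blast
  obtain CB where CB: "\<forall>\<^sub>F \<nu> in at_right 0. C1_on {0..} (SB \<nu>) \<and> C1_on {0..} (RB \<nu>) \<and>
      C1_norm_le {0..} (SB \<nu>) CB \<and> C1_norm_le {0..} (RB \<nu>) CB \<and> (\<forall>t\<in>{0..}. 0 < SB \<nu> t \<and> SB \<nu> t < RB \<nu> t)"
    using A4 unfolding admissible_data_def by blast
  obtain C where C: "\<forall>\<^sub>F \<nu> in at_right 0.
        (\<forall>x\<in>I. deriv_on I (S0 \<nu>) x \<ge> 0 \<and> deriv_on I (R0 \<nu>) x \<ge> 0 \<and>
               \<bar>xi (S0 \<nu> x) (R0 \<nu> x)\<bar> \<le> C * sqrt \<nu>) \<and>
        (\<forall>t\<ge>0. deriv_on {0..} (SB \<nu>) t \<le> 0 \<and> deriv_on {0..} (RB \<nu>) t \<le> 0 \<and>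
               \<bar>xi (SB \<nu> t) (RB \<nu> t)\<bar> \<le> C * sqrt \<nu>)"
    using A5 unfolding monotone_small_data_def by blast
  have lim: "((\<lambda>\<nu>. C * sqrt \<nu>) \<longlongrightarrow> C * sqrt 0) (at_right 0)"
      "((\<lambda>\<nu>. C0 * (C * sqrt \<nu>)) \<longlongrightarrow> C0 * (C * sqrt 0)) (at_right 0)"
    by (intro tendsto_intros)+
  have "\<forall>\<^sub>F \<nu> in at_right 0. C * sqrt \<nu> < X" "\<forall>\<^sub>F \<nu> in at_right 0. C0 * (C * sqrt \<nu>) < 1"
    using order_tendstoD(2)[OF lim(1), of X] order_tendstoD(2)[OF lim(2), of 1] X(1) by auto
  with C0 CB C initial
  have "\<forall>\<^sub>F \<nu> in at_right 0.
       (\<forall>x\<in>I. 0 < S0 \<nu> x \<and> S0 \<nu> x < R0 \<nu> x \<and> 0 \<le> deriv_on I (R0 \<nu>) x \<and>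
         source \<gamma> (k x) (S0 \<nu> x) (R0 \<nu> x) \<le> lam1 \<gamma> (S0 \<nu> x) (R0 \<nu> x) * deriv_on I (S0 \<nu>) x) \<and>
       (\<forall>t\<ge>0. 0 < SB \<nu> t \<and> SB \<nu> t < RB \<nu> t \<and>
         deriv_on {0..} (SB \<nu>) t \<le> 0 \<and> deriv_on {0..} (RB \<nu>) t \<le> 0)"
    (is "eventually ?good _")
  proof eventually_elim
    case (elim \<nu>)
    show ?case
    proof (intro conjI ballI allI impI)
      fix x assume x: "x \<in> I"
      show s: "0 < S0 \<nu> x" "S0 \<nu> x < R0 \<nu> x" and "0 \<le> deriv_on I (R0 \<nu>) x"
        using elim(1,3) x by auto
      have xi_le: "xi (S0 \<nu> x) (R0 \<nu> x) \<le> C * sqrt \<nu>" using elim(3) x by auto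
      then have small: "xi (S0 \<nu> x) (R0 \<nu> x) \<le> X" using elim(5) by linarith
      have "\<bar>S0 \<nu> x\<bar> \<le> C0" using elim(1) x by (simp add: C1_norm_le_def)
      moreover have "R0 \<nu> x - S0 \<nu> x = S0 \<nu> x * xi (S0 \<nu> x) (R0 \<nu> x)" "0 \<le> xi (S0 \<nu> x) (R0 \<nu> x)"
        using s by (auto simp: xi_def field_simps)
      ultimately have "R0 \<nu> x - S0 \<nu> x \<le> C0 * (C * sqrt \<nu>)" using xi_le s by (auto intro!: mult_mono)
      then have "R0 \<nu> x - S0 \<nu> x \<le> 1" using elim(6) by linarith
      then show "source \<gamma> (k x) (S0 \<nu> x) (R0 \<nu> x) \<le> lam1 \<gamma> (S0 \<nu> x) (R0 \<nu> x) * deriv_on I (S0 \<nu>) x"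
        using small X(2-4)
        by (intro initial_source_le_transport[where S = "S0 \<nu>" and R = "R0 \<nu>" and k = k,
              OF gamma elim(4) x b_neg s k0[OF x]]) auto
    qed (use elim(2,3) in auto)
  qed
  then obtain \<nu>0 where \<nu>0: "0 < \<nu>0" "\<And>\<nu>. 0 < \<nu> \<Longrightarrow> \<nu> < \<nu>0 \<Longrightarrow> ?good \<nu>"
    unfolding eventually_at_right_field by blast
  show ?thesis
  proof (intro exI[of _ "\<nu>0 / 2"] conjI allI impI ballI)
    show "0 < \<nu>0 / 2" using \<nu>0(1) by simp
  next
    fix \<nu> S R lam J x
    assume \<nu>: "0 < \<nu> \<and> \<nu> \<le> \<nu>0 / 2"
      and sol: "global_C1_solution \<gamma> I xB k (S0 \<nu>) (R0 \<nu>) (SB \<nu>) (RB \<nu>) S R"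
      and lam: "lam \<in> {lam1 \<gamma>, lam2 \<gamma>}"
    have good: "?good \<nu>" using \<nu> \<nu>0 by auto
    obtain Sx St Rx Rt where
      pd: "partials_on (I \<times> {0..}) S Sx St" "partials_on (I \<times> {0..}) R Rx Rt" and
      inv: "\<And>x t. x \<in> I \<Longrightarrow> 0 \<le> t \<Longrightarrow> 0 < S x t \<and> S x t < R x t \<and> St x t \<le> 0 \<and> Rt x t \<le> 0 \<and>
       St x t + lam1 \<gamma> (S x t) (R x t) * Sx x t = source \<gamma> (k x) (S x t) (R x t) \<and>
       Rt x t + lam2 \<gamma> (S x t) (R x t) * Rx x t = - source \<gamma> (k x) (S x t) (R x t)"
      using solution_invariants[OF gamma I A1 _ _ sol] good by blast
    have curve: "\<exists>t0\<in>J. is_interval J \<and> (\<forall>t\<in>J. t0 \<le> t) \<and> (\<forall>t\<in>J. 0 \<le> t \<and> x t \<in> I) \<and>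
         mono_on J (\<lambda>t. S (x t) t) \<and> antimono_on J (\<lambda>t. R (x t) t) \<and>
         antimono_on J (\<lambda>t. xi (S (x t) t) (R (x t) t))"
      if cc: "char_curve I xB lam S R J x" for J x
    proof -
      obtain t0 where t0: "t0 \<in> J" "\<forall>t\<in>J. t0 \<le> t" "0 \<le> t0"
        using cc unfolding char_curve_def by auto
      have J: "is_interval J" "\<And>t. t \<in> J \<Longrightarrow> 0 \<le> t" using cc t0 unfolding char_curve_def by force+
      have x: "\<And>t. t \<in> J \<Longrightarrow> x t \<in> I \<and> (x has_real_derivative lam (S (x t) t) (R (x t) t)) (at t within J)"
        using cc unfolding char_curve_def by blast
      from char_curve_monotone[OF gamma k0 pd inv lam J x] show ?thesis
        using t0 J x by blast
    qed
    show "mono_on J (\<lambda>t. S (x t) t)" if "char_curve I xB lam S R J x" using curve[OF that] by blast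
    show "antimono_on J (\<lambda>t. R (x t) t)" if "char_curve I xB lam S R J x" using curve[OF that] by blast
    show "antimono_on J (\<lambda>t. xi (S (x t) t) (R (x t) t))" if "char_curve I xB lam S R J x"
      using curve[OF that] by blast
    show "((\<lambda>t. xi (S (x t) t) (R (x t) t)) \<longlongrightarrow> 0) (right_end J) \<longleftrightarrow>
            ((\<lambda>t. gas_density \<gamma> \<nu> (S (x t) t) (R (x t) t)) \<longlongrightarrow> 0) (right_end J)"
      if "maximal_char_curve I xB lam S R J x"
    proof -
      have "char_curve I xB lam S R J x" using that by (simp add: maximal_char_curve_def)
      from curve[OF this] obtain t0 where t0: "t0 \<in> J" "\<forall>t\<in>J. t0 \<le> t" and J: "is_interval J"
        and xI: "\<forall>t\<in>J. 0 \<le> t \<and> x t \<in> I" and mono: "mono_on J (\<lambda>t. S (x t) t)" "antimono_on J (\<lambda>t. R (x t) t)"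
        by blast
      \<comment> \<open>The curve stays in the region \<open>S(t0) \<le> S \<le> R \<le> R(t0)\<close>, where \<open>t0\<close> is its starting time.\<close>
      have "\<forall>\<^sub>F t in right_end J. S (x t0) t0 \<le> S (x t) t \<and> S (x t) t \<le> R (x t) t \<and> R (x t) t \<le> R (x t0) t0"
        using eventually_right_end[OF J t0(1)]
      proof eventually_elim
        case (elim t)
        then show ?case
          using monotone_onD[OF mono(1) t0(1) elim] monotone_onD[OF mono(2) t0(1) elim] t0(2) xI inv[of "x t" t]
          by auto
      qed
      then show ?thesis
        using \<nu> xI t0(1) inv[of "x t0" t0] by (intro xi_tendsto_0_iff_density[OF gamma(1)]) auto
    qed
  qed
qed

end
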